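(* Let $\mathrm{L}$, $\mathrm{M}$, $\mathrm{D}$, $\mathrm{MG}_2$ denote the Lagrange, Markov, Dirichlet and two-dimensional Mordell-Gruber spectra, and let $W(t;\Lambda)$ denote the log-systole function of a lattice $\Lambda$ (all defined in the context). Then 1. $\mathrm{L} = \{\exp(-2\liminf_{t} W(t;\Lambda)) : \Lambda \text{ a unimodular bi-infinite lattice in } \mathbb{R}^2\}$; 2. $\mathrm{M} = \{\exp(-2\inf_{t} W(t;\Lambda)) : \Lambda \text{ a unimodular bi-infinite lattice in } \mathbb{R}^2\}$; 3. $\mathrm{D} = \{\exp(2\limsup_{t} W(t;\Lambda)) : \Lambda \text{ a unimodular bi-infinite lattice in } \mathbb{R}^2\}$; 4. $\mathrm{MG}_2 = \{\exp(2\sup_{t} W(t;\Lambda)) : \Lambda \text{ a unimodular bi-infinite lattice in } \mathbb{R}^2\}$.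
   Context: A unimodular lattice in $\mathbb{R}^2$ is $\Lambda=\mathbb{Z}A+\mathbb{Z}B$ with $|\det(A;B)|=1$. It is bi-infinite if its only point on either coordinate axis is $(0,0)$. Let $g_t=\mathrm{diag}(e^t,e^{-t})$, $\mathrm{sys}(\Lambda)=\min_{A\in\Lambda\setminus\{(0,0)\}}\|A\|_\infty$ where $\|\cdot\|_\infty$ is the $\ell^\infty$ norm on $\mathbb{R}^2$, and $W(t;\Lambda)=\ln(\mathrm{sys}(g_t\Lambda))$ for $t\in\mathbb{R}$. Here $\inf_t,\sup_t$ are over $t\in\mathbb{R}$ and $\liminf_t,\limsup_t$ are as $|t|\to\infty$. Values in the extended reals are allowed, with $\exp(+\infty)=+\infty$ and $0^{-1}=+\infty$. Lagrange spectrum: $\mathrm{L}=\{\limsup_{n\to\infty}(n\|n\alpha\|)^{-1}:\alpha\in\mathbb{R}\setminus\mathbb{Q}\}$, where $\|x\|$ is the distance from $x$ to $\mathbb{Z}$. Markov spectrum: $\mathrm{M}=\{(\inf_{(x,y)\in\mathbb{Z}^2\setminus\{(0,0)\}}|f(x,y)|)^{-1}\}$, where $f$ ranges over real quadratic forms $f(x,y)=ax^2+bxy+cy^2$ with $b^2-4ac=1$ (the value $\infty$ is allowed). Dirichlet spectrum: $\mathrm{D}=\{\mu(\alpha):\alpha\in\mathbb{R}\setminus\mathbb{Q}\}$, where $\mu(\alpha)=\limsup_{t\in\mathbb{N},\,t\to\infty}\; t\cdot\min\{|q\alpha-p| : p,q\in\mathbb{Z},\ 0<q\le t\}$. Mordell-Gruber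 spectrum: a rectangle $[-x,x]\times[-y,y]$ ($x,y>0$) is admissible in $\Lambda$ if its only point in $\Lambda$ is $(0,0)$; $\kappa(\Lambda)=\sup xy$ over all admissible rectangles; $\mathrm{MG}_2=\{\kappa(\Lambda):\Lambda\text{ a unimodular lattice in }\mathbb{R}^2\}$. *)

theory Defs
  imports "HOL-Analysis.Analysis"
begin

definition exp_ereal :: "ereal \<Rightarrow> ereal" where
  "exp_ereal x = (case x of ereal r \<Rightarrow> ereal (exp r) | PInfty \<Rightarrow> \<infinity> | MInfty \<Rightarrow> 0)"

lemma exp_ereal_simps [simp]:
  "exp_ereal (ereal r) = ereal (exp r)"
  "exp_ereal \<infinity> = \<infinity>"
  "exp_ereal (- \<infinity>) = 0"
  by (simp_all add: exp_ereal_def)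

definition lattice_of :: "real^2 \<Rightarrow> real^2 \<Rightarrow> (real^2) set" where
  "lattice_of A B = {of_int m *\<^sub>R A + of_int n *\<^sub>R B | m n :: int. True}"

definition unimodular_lattice :: "(real^2) set \<Rightarrow> bool" where
  "unimodular_lattice \<Lambda> \<longleftrightarrow>
    (\<exists>A B. \<Lambda> = lattice_of A B \<and> \<bar>det (vector [A, B] :: real^2^2)\<bar> = 1)"

definition bi_infinite :: "(real^2) set \<Rightarrow> bool" where
  "bi_infinite \<Lambda> \<longleftrightarrow> (\<forall>v\<in>\<Lambda>. v $ 1 = 0 \<or> v $ 2 = 0 \<longrightarrow> v = 0)"

definition diag_flow :: "real \<Rightarrow> real^2^2" where
  "diag_flow t = vector [vector [exp t, 0], vector [0, exp (- t)]]"

text \<open>Here \<^const>\<open>infnorm\<close> is the sup norm. The infimum below is a minimum for every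
  lattice, by discreteness.\<close>

definition sys :: "(real^2) set \<Rightarrow> real" where
  "sys \<Lambda> = (INF v\<in>\<Lambda> - {0}. infnorm v)"

definition log_systole :: "(real^2) set \<Rightarrow> real \<Rightarrow> real" where
  "log_systole \<Lambda> t = ln (sys ((*v) (diag_flow t) ` \<Lambda>))"

text \<open>All four spectra are sets of extended reals, where \<open>inverse 0 = \<infinity>\<close>. Irrelevant terms such as
  \<open>n = 0\<close> do not influence the limits superior.\<close>

definition lagrange_spectrum :: "ereal set" where
  "lagrange_spectrum =
    {Limsup sequentially (\<lambda>n. inverse (ereal (real n * infdist (real n * \<alpha>) \<int>))) | \<alpha> :: real.
      \<alpha> \<notin> \<rat>}"

definition markov_spectrum :: "ereal set" where
  "markov_spectrum =
    {inverse (INF (x, y) \<in> (UNIV :: (int \<times> int) set) - {(0, 0)}.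
        ereal \<bar>a * (of_int x)\<^sup>2 + b * of_int x * of_int y + c * (of_int y)\<^sup>2\<bar>) | a b c :: real.
      b\<^sup>2 - 4 * a * c = 1}"

text \<open>For \<open>t \<ge> 1\<close> the real infimum below is a minimum: for each of the finitely many \<open>q\<close>, it is attained
  at an integer \<open>p\<close> nearest to \<open>q * \<alpha>\<close>.\<close>

definition dirichlet_const :: "real \<Rightarrow> ereal" where
  "dirichlet_const \<alpha> = Limsup sequentially
    (\<lambda>t :: nat. ereal (real t *
      Inf {\<bar>of_int q * \<alpha> - of_int p\<bar> | p q :: int. 0 < q \<and> q \<le> int t}))"

definition dirichlet_spectrum :: "ereal set" where
  "dirichlet_spectrum = {dirichlet_const \<alpha> | \<alpha>. \<alpha> \<notin> \<rat>}"

definition admissible :: "(real^2) set \<Rightarrow> real \<Rightarrow> real \<Rightarrow> bool" where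
  "admissible \<Lambda> x y \<longleftrightarrow>
    0 < x \<and> 0 < y \<and> {v \<in> \<Lambda>. v $ 1 \<in> {- x..x} \<and> v $ 2 \<in> {- y..y}} = {0}"

definition mordell_const :: "(real^2) set \<Rightarrow> ereal" where
  "mordell_const \<Lambda> = Sup {ereal (x * y) | x y. admissible \<Lambda> x y}"

definition mordell_gruber_spectrum :: "ereal set" where
  "mordell_gruber_spectrum = {mordell_const \<Lambda> | \<Lambda>. unimodular_lattice \<Lambda>}"

end

theory Submission
  imports Defs
begin

text \<open>Write \<open>S(t)\<close> for the square of the systole of \<open>g\<^sub>t \<Lambda>\<close> (\<open>sq_sys\<close>). Since the
  exponential is continuous and increasing, the four right-hand sides are the limit superior of
  \<open>1/S\<close>, the supremum of \<open>1/S\<close>, the limit superior of \<open>S\<close> and the supremum of \<open>S\<close>. No continued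
  fractions are needed, because \<open>S\<close> can be read off from empty boxes: \<open>c \<le> S(t)\<close> says that the open
  box with half sides \<open>\<surd>c e\<^sup>-\<^sup>t\<close> and \<open>\<surd>c e\<^sup>t\<close> has no nonzero lattice point (\<open>le_sq_sys_iff\<close>), and
  conversely every empty box with half sides \<open>X\<close>, \<open>Y\<close> forces \<open>X Y \<le> S(t)\<close> at the time \<open>t\<close> which
  makes it a square. In the same way a lattice point \<open>v\<close> gives \<open>S(t) \<le> \<bar>v\<^sub>1 v\<^sub>2\<bar>\<close> at the time
  when \<open>g\<^sub>t v\<close> is on a diagonal.

  \<^bold>\<open>Lagrange and Dirichlet.\<close> If \<open>A\<close>, \<open>B\<close> is a basis of \<open>\<Lambda>\<close> and \<open>\<alpha> = - B\<^sub>1/A\<^sub>1\<close>, then \<open>v = mA + nB\<close> has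
  \<open>\<bar>v\<^sub>1\<bar> = \<bar>A\<^sub>1\<bar> \<bar>m - n\<alpha>\<bar>\<close> and, the determinant being \<open>1\<close> or \<open>-1\<close>, \<open>\<bar>A\<^sub>1\<bar> \<bar>v\<^sub>2\<bar> = \<bar>n\<bar>\<close> up to a multiple of
  \<open>\<bar>m - n\<alpha>\<bar>\<close>. Up to an error that vanishes in the limit, boxes flat in the first
  direction are thus the inequalities \<open>\<bar>m - n\<alpha>\<bar> < \<delta>\<close>, \<open>\<bar>n\<bar> < T\<close> of Diophantine approximation. Hence as
  \<open>t \<rightarrow> +\<infinity>\<close> the two limits superior depend on \<open>\<alpha>\<close> only: they are its Lagrange and its Dirichlet
  constant (\<open>Limsup_inverse_sq_sys_at_top\<close>, \<open>Limsup_sq_sys_at_top\<close>). Exchanging the coordinates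
  reverses time, so \<open>t \<rightarrow> -\<infinity>\<close> gives the constants of the other slope, and the limit over \<open>\<bar>t\<bar> \<rightarrow> \<infinity>\<close>
  is the maximum of two elements of the spectrum. Every \<open>\<alpha>\<close> does occur, in a lattice whose two
  slopes are \<open>\<alpha>\<close> and \<open>\<alpha> + 1\<close>.

  \<^bold>\<open>Markov.\<close> The supremum of \<open>1/S\<close> is the inverse of the infimum of \<open>\<bar>v\<^sub>1 v\<^sub>2\<bar>\<close> over nonzero lattice
  points, and in the coordinates of a basis \<open>v\<^sub>1 v\<^sub>2\<close> is a quadratic form of discriminant \<open>1\<close>. Every such
  form without nontrivial integral zero arises from a bi-infinite lattice. The remaining forms have the
  value \<open>\<infinity>\<close>.

  \<^bold>\<open>Mordell--Gruber.\<close> The constant of \<^emph>\<open>every\<close> unimodular lattice is the supremum of \<open>S\<close>. It is at most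
  \<open>1\<close> by Minkowski's theorem for squares, and a nonzero point \<open>v\<close> forces it to be at least \<open>1 - \<bar>v\<^sub>1 v\<^sub>2\<bar>\<close>,
  because the lattice lies on lines parallel to a primitive vector. So lattices with a nonzero point on an axis have
  constant \<open>1\<close>.

  The two exceptional values \<open>\<infinity>\<close> and \<open>1\<close> are both attained by one bi-infinite lattice, which is
  built from an irrational number with infinite Lagrange constant (\<open>bi_infinite_lattice_extreme_sys\<close>).\<close>

section \<open>Limits superior of extended real functions\<close>

lemma mono_exp_ereal: "mono exp_ereal"
proof
  show "exp_ereal x \<le> exp_ereal y" if "x \<le> y" for x y
    using that by (cases x; cases y) auto
qed

text \<open>A monotone surjection is continuous, and \<open>exp_ereal\<close> becomes one when its values are
  regarded as extended nonnegative reals.\<close>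

lemma continuous_on_exp_ereal: "continuous_on UNIV exp_ereal"
proof -
  have nonneg: "0 \<le> exp_ereal x" for x
    by (cases x) auto
  have surj_exp: "\<exists>x. y = e2ennreal (exp_ereal x)" for y
  proof (cases y rule: ennreal_cases)
    case (real r)
    show ?thesis
    proof (cases "r = 0")
      case True
      then show ?thesis
        using real by (intro exI[of _ "-\<infinity>"]) (simp add: zero_ennreal.abs_eq)
    next
      case False
      then show ?thesis
        using real by (intro exI[of _ "ereal (ln r)"]) (simp add: e2ennreal_ereal)
    qed
  next
    case top
    then show ?thesis
      by (intro exI[of _ \<infinity>]) simp
  qed
  then have "range (\<lambda>x. e2ennreal (exp_ereal x)) = UNIV"
    by auto
  then have "continuous_on UNIV (\<lambda>x. e2ennreal (exp_ereal x))"
    by (intro continuous_onI_mono) (auto intro!: e2ennreal_mono monoD[OF mono_exp_ereal])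
  then have "continuous_on UNIV (\<lambda>x. enn2ereal (e2ennreal (exp_ereal x)))"
    by (rule continuous_on_compose2[OF continuous_on_enn2ereal]) simp
  then show ?thesis
    by (simp add: enn2ereal_e2ennreal nonneg)
qed

lemma Limsup_exp_ereal:
  assumes "F \<noteq> bot"
  shows "exp_ereal (2 * Limsup F f) = Limsup F (\<lambda>t. exp_ereal (2 * f t))"
proof -
  have "continuous_on UNIV (\<lambda>x :: ereal. 2 * x)"
    using continuous_on_cmult_ereal[of 2 UNIV "\<lambda>x. x"] by simp
  then have "continuous_on UNIV (\<lambda>x. exp_ereal (2 * x))"
    by (rule continuous_on_compose2[OF continuous_on_exp_ereal]) simp
  moreover have "mono (\<lambda>x. exp_ereal (2 * x))"
    by (intro monoI monoD[OF mono_exp_ereal] ereal_mult_left_mono) auto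
  ultimately show ?thesis
    using Limsup_compose_continuous_mono[of "\<lambda>x. exp_ereal (2 * x)" F f] assms by simp
qed

lemma Limsup_exp_ereal_minus:
  assumes "F \<noteq> bot"
  shows "exp_ereal (- 2 * Liminf F f) = Limsup F (\<lambda>t. exp_ereal (- 2 * f t))"
proof -
  have neg: "- 2 * x = 2 * (- x)" for x :: ereal
    by (cases x) auto
  show ?thesis
    unfolding neg ereal_Limsup_uminus[symmetric] by (rule Limsup_exp_ereal[OF assms])
qed

text \<open>The supremum and the infimum are limits along the filter \<open>top\<close>, so that one
  commutation rule for the exponential covers all four spectra.\<close>

lemma Limsup_top_filter:
  fixes f :: "'a \<Rightarrow> 'b::complete_lattice" shows "Limsup top f = (SUP x. f x)"
  by (rule antisym) (auto simp: Limsup_def eventually_top intro!: INF_lower2[of "\<lambda>_. True"] INF_greatest SUP_mono)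

lemma Liminf_top_filter:
  fixes f :: "'a \<Rightarrow> 'b::complete_lattice" shows "Liminf top f = (INF x. f x)"
  by (rule antisym) (auto simp: Liminf_def eventually_top intro!: SUP_upper2[of "\<lambda>_. True"] SUP_least INF_mono)

lemma Limsup_sup_filter:
  fixes f :: "'a \<Rightarrow> 'b::complete_linorder"
  shows "Limsup (sup F G) f = max (Limsup F f) (Limsup G f)"
proof (rule antisym)
  show "Limsup (sup F G) f \<le> max (Limsup F f) (Limsup G f)"
    by (subst Limsup_le_iff) (auto simp: eventually_sup dest: Limsup_lessD)
  show "max (Limsup F f) (Limsup G f) \<le> Limsup (sup F G) f"
    by (auto simp: Limsup_def eventually_sup intro!: INF_superset_mono)
qed

text \<open>Loosening the bound from \<open>r'\<close> to \<open>r\<close> leaves room for the error terms of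
  Diophantine approximation, which tend to \<open>0\<close> but do not vanish. Only positive real bounds matter
  because \<open>g\<close> is nonnegative.\<close>

lemma Limsup_le_Limsup_of_frequently:
  fixes f :: "'a \<Rightarrow> ereal" and g :: "'b \<Rightarrow> ereal"
  assumes "G \<noteq> bot" "\<And>x. 0 \<le> g x"
    and step: "\<And>r r'. \<lbrakk>0 < r; r < r'; \<exists>\<^sub>F x in F. ereal r' < f x\<rbrakk> \<Longrightarrow> \<exists>\<^sub>F x in G. ereal r < g x"
  shows "Limsup F f \<le> Limsup G g"
proof (rule dense_le)
  fix y assume y: "y < Limsup F f"
  show "y \<le> Limsup G g"
  proof (cases "y \<le> 0")
    case True
    have "0 \<le> Limsup G g"
      using assms(1,2) by (intro le_Limsup) auto
    then show ?thesis
      using True by simp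
  next
    case False
    obtain r' where r': "y < ereal r'" "ereal r' < Limsup F f"
      using ereal_dense2[OF y] by auto
    then obtain r where r: "y = ereal r"
      using False by (cases y) auto
    have "\<exists>\<^sub>F x in F. ereal r' < f x"
      using r'(2) Limsup_bounded[of f "ereal r'" F] by (force simp: frequently_def not_less)
    then have "\<exists>\<^sub>F x in G. ereal r < g x"
      using False r r' by (intro step[of r r']) auto
    show ?thesis
    proof (rule ccontr)
      assume "\<not> y \<le> Limsup G g"
      then have "eventually (\<lambda>x. g x < y) G"
        by (intro Limsup_lessD) auto
      with \<open>\<exists>\<^sub>F x in G. ereal r < g x\<close> show False
        unfolding r frequently_def by (metis (mono_tags, lifting) eventually_mono less_asym)
    qed
  qed
qed

section \<open>The squared systole and empty boxes\<close>

definition sq_sys :: "(real^2) set \<Rightarrow> real \<Rightarrow> real" where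
  "sq_sys \<Lambda> t = (sys ((*v) (diag_flow t) ` \<Lambda>))\<^sup>2"

text \<open>Open boxes correspond to the non-strict inequality \<open>c \<le> S(t)\<close>, whereas the
  rectangles in \<^const>\<open>admissible\<close> are closed. The difference disappears in the suprema.\<close>

definition avoids_box :: "(real^2) set \<Rightarrow> real \<Rightarrow> real \<Rightarrow> bool" where
  "avoids_box \<Lambda> X Y \<longleftrightarrow> (\<forall>v\<in>\<Lambda>. v \<noteq> 0 \<longrightarrow> X \<le> \<bar>v $ 1\<bar> \<or> Y \<le> \<bar>v $ 2\<bar>)"

lemma lattice_ofE:
  assumes "v \<in> lattice_of A B"
  obtains m n :: int where "v $ 1 = of_int m * A $ 1 + of_int n * B $ 1"
    "v $ 2 = of_int m * A $ 2 + of_int n * B $ 2"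
  using assms by (auto simp: lattice_of_def)

lemma lattice_ofI: "of_int m *\<^sub>R A + of_int n *\<^sub>R B \<in> lattice_of A B"
  by (auto simp: lattice_of_def)

lemma det_rows: "det (vector [A, B] :: real^2^2) = A $ 1 * B $ 2 - A $ 2 * B $ 1"
  by (simp add: det_2 vector_2)

lemma unimodular_latticeE:
  assumes "unimodular_lattice \<Lambda>"
  obtains A B where "\<Lambda> = lattice_of A B" "\<bar>A $ 1 * B $ 2 - A $ 2 * B $ 1\<bar> = 1"
  using assms by (auto simp: unimodular_lattice_def det_rows)

lemma unimodular_latticeI:
  "\<bar>A $ 1 * B $ 2 - A $ 2 * B $ 1\<bar> = 1 \<Longrightarrow> unimodular_lattice (lattice_of A B)"
  by (auto simp: unimodular_lattice_def det_rows)

lemma vec2_eq_0_iff: "(v :: real^2) = 0 \<longleftrightarrow> v $ 1 = 0 \<and> v $ 2 = 0"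
  by (simp add: vec_eq_iff forall_2)

lemma lattice_comb_eq_0_iff:
  fixes m n :: int
  assumes "\<bar>A $ 1 * B $ 2 - A $ 2 * B $ 1\<bar> = (1 :: real)"
  shows "of_int m *\<^sub>R A + of_int n *\<^sub>R (B :: real^2) = 0 \<longleftrightarrow> m = 0 \<and> n = 0"
proof
  assume eq: "of_int m *\<^sub>R A + of_int n *\<^sub>R B = 0"
  have e1: "of_int m * A $ 1 + of_int n * B $ 1 = 0" and e2: "of_int m * A $ 2 + of_int n * B $ 2 = 0"
    using eq by (auto simp: vec2_eq_0_iff)
  have "of_int m * (A $ 1 * B $ 2 - A $ 2 * B $ 1) = 0" "of_int n * (A $ 1 * B $ 2 - A $ 2 * B $ 1) = 0"
    using e1 e2 by algebra+
  then show "m = 0 \<and> n = 0"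
    using assms by auto
qed simp

lemma diag_flow_mult [simp]:
  "(diag_flow t *v v) $ 1 = exp t * v $ 1" "(diag_flow t *v v) $ 2 = exp (- t) * v $ 2"
  by (simp_all add: diag_flow_def matrix_vector_mult_def sum_2)

lemma le_exp_flow_iff:
  "r \<le> exp t * x \<longleftrightarrow> r * exp (- t) \<le> x" "r \<le> exp (- t) * x \<longleftrightarrow> r * exp t \<le> x"
  for r t x :: real
  by (simp_all add: exp_minus field_simps)

lemma unimodular_nonzero:
  assumes "unimodular_lattice \<Lambda>" shows "\<exists>v\<in>\<Lambda>. v \<noteq> 0"
proof -
  obtain A B where AB: "\<Lambda> = lattice_of A B" "\<bar>A $ 1 * B $ 2 - A $ 2 * B $ 1\<bar> = 1"
    using assms by (rule unimodular_latticeE)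
  then have "A \<noteq> 0" by auto
  moreover have "A \<in> \<Lambda>"
    using lattice_ofI[of 1 A 0 B] AB by simp
  ultimately show ?thesis by blast
qed

lemma le_sys_flow_iff:
  assumes "unimodular_lattice \<Lambda>"
  shows "r \<le> sys ((*v) (diag_flow t) ` \<Lambda>) \<longleftrightarrow> avoids_box \<Lambda> (r * exp (- t)) (r * exp t)"
proof -
  let ?g = "\<lambda>v. diag_flow t *v v"
  have "?g v = 0 \<longleftrightarrow> v = 0" for v :: "real^2"
    by (simp add: vec2_eq_0_iff)
  then have eq: "?g ` \<Lambda> - {0} = ?g ` (\<Lambda> - {0})"
    by auto
  have ne: "?g ` (\<Lambda> - {0}) \<noteq> {}"
    using unimodular_nonzero[OF assms] by auto
  have bdd: "bdd_below (infnorm ` ?g ` (\<Lambda> - {0}))"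
    by (rule bdd_belowI[of _ 0]) (auto simp: infnorm_pos_le)
  have "r \<le> sys (?g ` \<Lambda>) \<longleftrightarrow> (\<forall>v\<in>\<Lambda> - {0}. r \<le> infnorm (?g v))"
    unfolding sys_def eq using le_cINF_iff[OF ne bdd] by auto
  also have "\<dots> \<longleftrightarrow> avoids_box \<Lambda> (r * exp (- t)) (r * exp t)"
    by (auto simp: avoids_box_def infnorm_2 le_max_iff_disj abs_mult le_exp_flow_iff)
  finally show ?thesis .
qed

text \<open>Discreteness: by Cramer's rule the coefficients of a lattice point are bounded by a
  multiple of its coordinates, and the coefficients are integers.\<close>

lemma avoids_box_small:
  assumes "unimodular_lattice \<Lambda>"
  obtains r where "0 < r" "avoids_box \<Lambda> r r"
proof -
  obtain A B where AB: "\<Lambda> = lattice_of A B" "\<bar>A $ 1 * B $ 2 - A $ 2 * B $ 1\<bar> = 1"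
    using assms by (rule unimodular_latticeE)
  define K where "K = \<bar>A $ 1\<bar> + \<bar>A $ 2\<bar> + \<bar>B $ 1\<bar> + \<bar>B $ 2\<bar>"
  have "K > 0"
    using AB(2) by (cases "A $ 1 = 0"; cases "A $ 2 = 0") (auto simp: K_def add_pos_nonneg)
  have "avoids_box \<Lambda> (1 / K) (1 / K)"
    unfolding avoids_box_def
  proof (intro ballI impI, rule ccontr)
    fix v assume v: "v \<in> \<Lambda>" "v \<noteq> 0" and small: "\<not> (1 / K \<le> \<bar>v $ 1\<bar> \<or> 1 / K \<le> \<bar>v $ 2\<bar>)"
    obtain m n :: int where mn: "v $ 1 = of_int m * A $ 1 + of_int n * B $ 1"
      "v $ 2 = of_int m * A $ 2 + of_int n * B $ 2"
      using v AB(1) by (auto elim: lattice_ofE)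
    have less1: "\<bar>v $ 1 * b - v $ 2 * a\<bar> < 1" if "\<bar>a\<bar> + \<bar>b\<bar> \<le> K" for a b
    proof -
      have "\<bar>v $ 1 * b - v $ 2 * a\<bar> \<le> \<bar>v $ 1\<bar> * \<bar>b\<bar> + \<bar>v $ 2\<bar> * \<bar>a\<bar>"
        by (metis abs_mult abs_triangle_ineq4)
      also have "\<dots> \<le> max \<bar>v $ 1\<bar> \<bar>v $ 2\<bar> * \<bar>b\<bar> + max \<bar>v $ 1\<bar> \<bar>v $ 2\<bar> * \<bar>a\<bar>"
        by (intro add_mono mult_right_mono) auto
      also have "\<dots> \<le> max \<bar>v $ 1\<bar> \<bar>v $ 2\<bar> * K"
        using that by (simp add: distrib_left[symmetric] mult_left_mono)
      also have "\<dots> < 1 / K * K"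
        using small \<open>K > 0\<close> by (intro mult_strict_right_mono) auto
      finally show ?thesis
        using \<open>K > 0\<close> by simp
    qed
    have "\<bar>of_int m * (A $ 1 * B $ 2 - A $ 2 * B $ 1)\<bar> < 1"
      using less1[of "B $ 1" "B $ 2"] by (simp add: mn K_def algebra_simps)
    moreover have "\<bar>of_int n * (A $ 1 * B $ 2 - A $ 2 * B $ 1)\<bar> < 1"
      using less1[of "A $ 1" "A $ 2"] by (simp add: mn K_def algebra_simps abs_minus_commute)
    ultimately have "m = 0 \<and> n = 0"
      using AB(2) by (auto simp: abs_mult)
    then show False
      using v mn by (auto simp: vec2_eq_0_iff)
  qed
  then show ?thesis
    using \<open>K > 0\<close> by (intro that[of "1 / K"]) auto
qed

lemma avoids_box_mono:
  "avoids_box \<Lambda> X Y \<Longrightarrow> X' \<le> X \<Longrightarrow> Y' \<le> Y \<Longrightarrow> avoids_box \<Lambda> X' Y'"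
  by (force simp: avoids_box_def)

lemma sys_flow_pos:
  assumes "unimodular_lattice \<Lambda>" shows "0 < sys ((*v) (diag_flow t) ` \<Lambda>)"
proof -
  obtain r where r: "0 < r" "avoids_box \<Lambda> r r"
    using assms by (rule avoids_box_small)
  let ?s = "r * exp (- \<bar>t\<bar>)"
  have "r * (exp (- \<bar>t\<bar>) * exp (- t)) \<le> r * 1" "r * (exp (- \<bar>t\<bar>) * exp t) \<le> r * 1"
    using r(1) by (intro mult_left_mono; simp flip: exp_add)+
  then have "avoids_box \<Lambda> (?s * exp (- t)) (?s * exp t)"
    using r(2) by (auto intro: avoids_box_mono simp: mult.assoc)
  then have "?s \<le> sys ((*v) (diag_flow t) ` \<Lambda>)"
    by (simp add: le_sys_flow_iff[OF assms])
  moreover have "0 < ?s"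
    using r(1) by simp
  ultimately show ?thesis by linarith
qed

lemma sq_sys_pos: "unimodular_lattice \<Lambda> \<Longrightarrow> 0 < sq_sys \<Lambda> t"
  using sys_flow_pos[of \<Lambda> t] by (simp add: sq_sys_def)

lemma le_sq_sys_iff:
  assumes "unimodular_lattice \<Lambda>" "0 \<le> c"
  shows "c \<le> sq_sys \<Lambda> t \<longleftrightarrow> avoids_box \<Lambda> (sqrt c * exp (- t)) (sqrt c * exp t)"
proof -
  have "c \<le> sq_sys \<Lambda> t \<longleftrightarrow> sqrt c \<le> sqrt (sq_sys \<Lambda> t)"
    by simp
  also have "sqrt (sq_sys \<Lambda> t) = sys ((*v) (diag_flow t) ` \<Lambda>)"
    unfolding sq_sys_def using sys_flow_pos[OF assms(1), of t] by simp
  finally have "c \<le> sq_sys \<Lambda> t \<longleftrightarrow> sqrt c \<le> sys ((*v) (diag_flow t) ` \<Lambda>)" .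
  then show ?thesis
    by (simp add: le_sys_flow_iff assms(1))
qed

text \<open>At time \<open>t = ln (Y / X) / 2\<close> the flow turns the box with half sides \<open>X\<close> and \<open>Y\<close>
  into a square of the same area.\<close>

lemma exp_half_ln_ratio:
  assumes "0 < X" "0 < (Y :: real)"
  shows "sqrt (X * Y) * exp (- (ln (Y / X) / 2)) = X" "sqrt (X * Y) * exp (ln (Y / X) / 2) = Y"
proof -
  define x y where "x = ln X" and "y = ln Y"
  have X: "X = exp x" and Y: "Y = exp y"
    using assms by (simp_all add: x_def y_def)
  have ratio: "ln (Y / X) = y - x"
    by (simp add: X Y flip: exp_diff)
  have "(exp ((x + y) / 2))\<^sup>2 = X * Y"
    unfolding X Y exp_double[symmetric] exp_add[symmetric] by (rule arg_cong[where f = exp]) simp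
  then have root: "sqrt (X * Y) = exp ((x + y) / 2)"
    by (intro real_sqrt_unique) auto
  have "sqrt (X * Y) * exp (- (ln (Y / X) / 2)) = exp x"
    unfolding root ratio exp_add[symmetric] by (rule arg_cong[where f = exp]) (simp add: field_simps)
  then show "sqrt (X * Y) * exp (- (ln (Y / X) / 2)) = X"
    by (simp only: X[symmetric])
  have "sqrt (X * Y) * exp (ln (Y / X) / 2) = exp y"
    unfolding root ratio exp_add[symmetric] by (rule arg_cong[where f = exp]) (simp add: field_simps)
  then show "sqrt (X * Y) * exp (ln (Y / X) / 2) = Y"
    by (simp only: Y[symmetric])
qed

lemma avoids_box_imp_le_sq_sys:
  assumes "unimodular_lattice \<Lambda>" "0 < X" "0 < Y" "avoids_box \<Lambda> X Y"
  shows "X * Y \<le> sq_sys \<Lambda> (ln (Y / X) / 2)"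
  using assms by (simp add: le_sq_sys_iff exp_half_ln_ratio)

text \<open>The flow moves \<open>v\<close> to a diagonal at this time and preserves the product of its
  coordinates.\<close>

lemma sq_sys_le_product:
  assumes "unimodular_lattice \<Lambda>" "v \<in> \<Lambda>" "v $ 1 \<noteq> 0" "v $ 2 \<noteq> 0"
  shows "sq_sys \<Lambda> (ln (\<bar>v $ 2\<bar> / \<bar>v $ 1\<bar>) / 2) \<le> \<bar>v $ 1 * v $ 2\<bar>"
proof (rule ccontr)
  let ?t = "ln (\<bar>v $ 2\<bar> / \<bar>v $ 1\<bar>) / 2" and ?P = "\<bar>v $ 1\<bar> * \<bar>v $ 2\<bar>"
  assume "\<not> ?thesis"
  then have less: "?P < sq_sys \<Lambda> ?t"
    by (simp add: abs_mult)
  have pos: "0 < \<bar>v $ 1\<bar>" "0 < \<bar>v $ 2\<bar>"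
    using assms by auto
  have "avoids_box \<Lambda> (sqrt (sq_sys \<Lambda> ?t) * exp (- ?t)) (sqrt (sq_sys \<Lambda> ?t) * exp ?t)"
    using le_sq_sys_iff[of \<Lambda> "sq_sys \<Lambda> ?t" ?t] assms(1) sq_sys_pos[of \<Lambda> ?t] by simp
  moreover have "v \<noteq> 0"
    using assms by auto
  ultimately have "sqrt (sq_sys \<Lambda> ?t) * exp (- ?t) \<le> \<bar>v $ 1\<bar> \<or> sqrt (sq_sys \<Lambda> ?t) * exp ?t \<le> \<bar>v $ 2\<bar>"
    using assms(2) by (simp add: avoids_box_def)
  moreover have "sqrt ?P * exp (- ?t) < sqrt (sq_sys \<Lambda> ?t) * exp (- ?t)"
    "sqrt ?P * exp ?t < sqrt (sq_sys \<Lambda> ?t) * exp ?t"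
    using less by simp_all
  ultimately show False
    unfolding exp_half_ln_ratio[OF pos] by linarith
qed

lemma sq_sys_ge:
  assumes "unimodular_lattice \<Lambda>" "0 \<le> c" "\<And>v. v \<in> \<Lambda> \<Longrightarrow> v \<noteq> 0 \<Longrightarrow> c \<le> \<bar>v $ 1 * v $ 2\<bar>"
  shows "c \<le> sq_sys \<Lambda> t"
proof -
  have False if "v \<in> \<Lambda>" "v \<noteq> 0" "\<bar>v $ 1\<bar> < sqrt c * exp (- t)" "\<bar>v $ 2\<bar> < sqrt c * exp t" for v
  proof -
    have "\<bar>v $ 1\<bar> * \<bar>v $ 2\<bar> < (sqrt c * exp (- t)) * (sqrt c * exp t)"
      using that by (intro mult_strict_mono') auto
    also have "\<dots> = c"
      using assms(2) by (simp add: exp_minus field_simps)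
    finally show False
      using assms(3)[OF that(1,2)] by (simp add: abs_mult)
  qed
  then show ?thesis
    unfolding le_sq_sys_iff[OF assms(1,2)] avoids_box_def by (meson not_less)
qed

lemma exp_ereal_log_systole:
  assumes "unimodular_lattice \<Lambda>"
  shows "exp_ereal (2 * ereal (log_systole \<Lambda> t)) = ereal (sq_sys \<Lambda> t)"
    "exp_ereal (- 2 * ereal (log_systole \<Lambda> t)) = ereal (inverse (sq_sys \<Lambda> t))"
  using sys_flow_pos[OF assms, of t]
  by (simp_all add: log_systole_def sq_sys_def exp_minus exp_double)

section \<open>The Lagrange constant as a limit along the flow\<close>

lemma frequently_at_top_real: "(\<exists>\<^sub>F t :: real in at_top. P t) \<longleftrightarrow> (\<forall>T. \<exists>t>T. P t)"
  by (auto simp: frequently_def eventually_at_top_dense)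

lemma infdist_Ints_le: "infdist x \<int> \<le> \<bar>of_int m - x\<bar>" for x :: real
  using infdist_le[of "of_int m" \<int> x] by (simp add: dist_real_def abs_minus_commute)

lemma infdist_Ints_round: "infdist x \<int> = \<bar>of_int (round x) - x\<bar>" for x :: real
proof (rule antisym)
  have "\<bar>of_int (round x) - x\<bar> \<le> dist x y" if "y \<in> \<int>" for y
    using that round_diff_minimal[of x] by (auto elim!: Ints_cases simp: dist_real_def abs_minus_commute)
  then show "\<bar>of_int (round x) - x\<bar> \<le> infdist x \<int>"
    by (subst infdist_notempty) (auto intro!: cINF_greatest)
qed (rule infdist_Ints_le)

lemma irrational_approx_ne_0:
  assumes "\<alpha> \<notin> \<rat>" "n \<noteq> 0" shows "of_int m - of_int n * \<alpha> \<noteq> (0 :: real)"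
proof
  assume "of_int m - of_int n * \<alpha> = 0"
  then have "\<alpha> = of_int m / of_int n"
    using assms(2) by (simp add: field_simps)
  then show False
    using assms(1) by (metis Rats_divide Rats_of_int)
qed

lemma infdist_irrational_pos:
  assumes "\<alpha> \<notin> \<rat>" "0 < n" shows "0 < infdist (real n * \<alpha>) \<int>"
  using irrational_approx_ne_0[OF assms(1), of "int n"] assms(2) by (simp add: infdist_Ints_round)

lemma infdist_irrational_lower_bound:
  assumes "\<alpha> \<notin> \<rat>"
  shows "\<exists>\<delta>>0. \<forall>n. 0 < n \<longrightarrow> n \<le> N \<longrightarrow> \<delta> \<le> infdist (real n * \<alpha>) \<int>"
proof (induction N)
  case 0
  show ?case by (rule exI[of _ 1]) auto
next
  case (Suc N)
  then obtain \<delta> where \<delta>: "\<delta> > 0" "\<And>n. 0 < n \<Longrightarrow> n \<le> N \<Longrightarrow> \<delta> \<le> infdist (real n * \<alpha>) \<int>"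
    by auto
  then show ?case
    using infdist_irrational_pos[OF assms, of "Suc N"]
    by (intro exI[of _ "min \<delta> (infdist (real (Suc N) * \<alpha>) \<int>)"]) (auto simp: le_Suc_eq min_le_iff_disj)
qed

text \<open>Coefficients of lattice points are signed, the denominators of the Lagrange constant are not.\<close>

lemma infdist_nat_abs_le: "infdist (real (nat \<bar>n\<bar>) * \<alpha>) \<int> \<le> \<bar>of_int m - of_int n * \<alpha>\<bar>"
proof (cases "0 \<le> n")
  case True
  then show ?thesis using infdist_Ints_le[of "of_int n * \<alpha>" m] by simp
next
  case False
  then show ?thesis using infdist_Ints_le[of "- of_int n * \<alpha>" "- m"] by simp
qed

lemma lattice_slope_coords:
  fixes A B :: "real^2" and m n :: int
  assumes "A $ 1 \<noteq> 0" "v = of_int m *\<^sub>R A + of_int n *\<^sub>R B"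
    and \<alpha>: "\<alpha> = - B $ 1 / A $ 1"
  shows "v $ 1 = A $ 1 * (of_int m - of_int n * \<alpha>)"
    "A $ 1 * v $ 2 = A $ 1 * A $ 2 * (of_int m - of_int n * \<alpha>) + of_int n * (A $ 1 * B $ 2 - A $ 2 * B $ 1)"
proof -
  have "B $ 1 = - \<alpha> * A $ 1"
    using assms by simp
  then show "v $ 1 = A $ 1 * (of_int m - of_int n * \<alpha>)"
    "A $ 1 * v $ 2 = A $ 1 * A $ 2 * (of_int m - of_int n * \<alpha>) + of_int n * (A $ 1 * B $ 2 - A $ 2 * B $ 1)"
    by (simp_all add: assms(2) algebra_simps)
qed

lemma less_inverse_ereal:
  assumes "0 < r" "x < 1 / r" "0 < x"
  shows "ereal r < inverse (ereal x)"
proof -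
  have "r < inverse x"
    using less_imp_inverse_less[OF assms(2,3)] by simp
  then show ?thesis
    using assms(3) by simp
qed

definition lagrange_const :: "real \<Rightarrow> ereal" where
  "lagrange_const \<alpha> = Limsup sequentially (\<lambda>n. inverse (ereal (real n * infdist (real n * \<alpha>) \<int>)))"

text \<open>The slope \<open>\<alpha>\<close> is chosen so that the first coordinate of \<open>mA + nB\<close> is a multiple of \<open>m - n\<alpha>\<close>.
  One unimodular lattice has many bases, and the slope depends on the basis.\<close>

locale slope_basis =
  fixes A B :: "real^2" and \<alpha> :: real and \<Lambda> :: "(real^2) set"
  assumes det: "\<bar>A $ 1 * B $ 2 - A $ 2 * B $ 1\<bar> = 1"
    and A1: "A $ 1 \<noteq> 0"
    and slope: "\<alpha> = - B $ 1 / A $ 1"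
    and irrational: "\<alpha> \<notin> \<rat>"
    and lattice: "\<Lambda> = lattice_of A B"
begin

lemma unimodular: "unimodular_lattice \<Lambda>"
  unfolding lattice by (rule unimodular_latticeI[OF det])

text \<open>The factor of the error made by reading \<open>\<bar>A\<^sub>1 v\<^sub>2\<bar>\<close> as \<open>\<bar>n\<bar>\<close> for \<open>v = mA + nB\<close>.\<close>

definition "skew = \<bar>A $ 1 * A $ 2\<bar>"

lemma skew_nonneg: "0 \<le> skew" by (simp add: skew_def)

text \<open>The dictionary between lattice points \<open>(v\<^sub>1, v\<^sub>2)\<close> and approximations \<open>m - n\<alpha>\<close>. It rests on the identity
  \<open>A\<^sub>1 v\<^sub>2 = A\<^sub>2 v\<^sub>1 + n det(A, B)\<close>.\<close>

lemma lattice_point: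
  fixes m n :: int
  defines "v \<equiv> of_int m *\<^sub>R A + of_int n *\<^sub>R B" and "u \<equiv> of_int m - of_int n * \<alpha>"
  shows "\<bar>v $ 1\<bar> = \<bar>A $ 1\<bar> * \<bar>u\<bar>" "\<bar>\<bar>A $ 1\<bar> * \<bar>v $ 2\<bar> - \<bar>of_int n\<bar>\<bar> \<le> skew * \<bar>u\<bar>" "v \<in> \<Lambda>"
    "v = 0 \<longleftrightarrow> m = 0 \<and> n = 0" "\<bar>\<bar>v $ 1 * v $ 2\<bar> - \<bar>of_int n\<bar> * \<bar>u\<bar>\<bar> \<le> skew * u\<^sup>2"
proof -
  note c = lattice_slope_coords[OF A1 _ slope, of v m n, folded u_def, OF v_def[THEN meta_eq_to_obj_eq]]
  show v1: "\<bar>v $ 1\<bar> = \<bar>A $ 1\<bar> * \<bar>u\<bar>"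
    by (simp add: c abs_mult)
  have "\<bar>\<bar>A $ 1 * v $ 2\<bar> - \<bar>of_int n * (A $ 1 * B $ 2 - A $ 2 * B $ 1)\<bar>\<bar> \<le> \<bar>A $ 1 * A $ 2 * u\<bar>"
    unfolding c(2) by linarith
  then show v2: "\<bar>\<bar>A $ 1\<bar> * \<bar>v $ 2\<bar> - \<bar>of_int n\<bar>\<bar> \<le> skew * \<bar>u\<bar>"
    by (simp add: abs_mult det skew_def)
  show "v \<in> \<Lambda>" by (auto simp: lattice v_def lattice_ofI)
  show "v = 0 \<longleftrightarrow> m = 0 \<and> n = 0" unfolding v_def by (rule lattice_comb_eq_0_iff[OF det])
  have "\<bar>v $ 1 * v $ 2\<bar> - \<bar>of_int n\<bar> * \<bar>u\<bar> = \<bar>u\<bar> * (\<bar>A $ 1\<bar> * \<bar>v $ 2\<bar> - \<bar>of_int n\<bar>)"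
    by (simp add: abs_mult v1 algebra_simps)
  also have "\<bar>\<dots>\<bar> \<le> \<bar>u\<bar> * (skew * \<bar>u\<bar>)"
    unfolding abs_mult[of "\<bar>u\<bar>"] using v2 by (auto intro: mult_left_mono)
  also have "\<dots> = skew * u\<^sup>2"
    by (simp add: power2_eq_square)
  finally show "\<bar>\<bar>v $ 1 * v $ 2\<bar> - \<bar>of_int n\<bar> * \<bar>u\<bar>\<bar> \<le> skew * u\<^sup>2" .
qed

lemma lattice_pointE:
  assumes "v \<in> \<Lambda>" obtains m n :: int where "v = of_int m *\<^sub>R A + of_int n *\<^sub>R B"
  using assms by (auto simp: lattice lattice_of_def)

text \<open>A good approximation \<open>m/n\<close> gives a lattice point with small product of coordinates, hence a small
  systole at the time when this point is on a diagonal. That time is large for large \<open>n\<close>, because the first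
  coordinate is of order at most \<open>1/n\<close> and the second one of order \<open>n\<close>.\<close>

lemma frequently_small_sys_if_approx:
  assumes r: "0 < r" "r < r'"
    and freq: "\<exists>\<^sub>F n in sequentially. ereal r' < inverse (ereal (real n * infdist (real n * \<alpha>) \<int>))"
  shows "\<exists>\<^sub>F t in at_top. ereal r < ereal (inverse (sq_sys \<Lambda> t))"
  unfolding frequently_at_top_real
proof
  fix T
  let ?a = "\<bar>A $ 1\<bar>"
  have a: "?a > 0" using A1 by simp
  have "1 / r' < 1 / r" using r by (simp add: frac_less2)
  \<comment> \<open>The first condition on \<open>n\<close> absorbs the error in the product, the second one makes the time exceed \<open>T\<close>.\<close>
  have "eventually (\<lambda>n. skew * (1 / (r' * real n))\<^sup>2 < 1 / r - 1 / r') sequentially"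
  proof (rule order_tendstoD(2))
    have "(\<lambda>n. skew * (1 / r' * inverse (real n))\<^sup>2) \<longlonglongrightarrow> skew * (1 / r' * 0)\<^sup>2"
      by (intro tendsto_intros lim_inverse_n)
    then show "(\<lambda>n. skew * (1 / (r' * real n))\<^sup>2) \<longlonglongrightarrow> 0"
      by (simp add: divide_simps)
  qed (use \<open>1 / r' < 1 / r\<close> in simp)
  moreover have "eventually (\<lambda>n. exp (2 * T) * ?a\<^sup>2 / (r' * real n) + skew / (r' * real n) < real n) sequentially"
  proof -
    let ?c = "exp (2 * T) * ?a\<^sup>2 / r' + skew / r'"
    have "eventually (\<lambda>n. n \<ge> 1 \<and> n > nat \<lceil>?c\<rceil>) sequentially"
      by (intro eventually_conj eventually_ge_at_top eventually_gt_at_top)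
    then show ?thesis
    proof (rule eventually_mono)
      fix n :: nat assume n: "n \<ge> 1 \<and> n > nat \<lceil>?c\<rceil>"
      have "0 \<le> ?c"
        using r skew_nonneg by simp
      have "exp (2 * T) * ?a\<^sup>2 / (r' * real n) + skew / (r' * real n) = ?c / real n"
        by (simp add: add_divide_distrib)
      also have "\<dots> \<le> ?c"
        using n \<open>0 \<le> ?c\<close> mult_left_mono[of 1 "real n" ?c] by (simp add: divide_le_eq)
      also have "?c < real n"
        using n by linarith
      finally show "exp (2 * T) * ?a\<^sup>2 / (r' * real n) + skew / (r' * real n) < real n" .
    qed
  qed
  moreover have "eventually (\<lambda>n. 1 \<le> n) sequentially"
    by (rule eventually_ge_at_top)
  ultimately have "eventually (\<lambda>n. skew * (1 / (r' * real n))\<^sup>2 < 1 / r - 1 / r' \<and>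
    exp (2 * T) * ?a\<^sup>2 / (r' * real n) + skew / (r' * real n) < real n \<and> 1 \<le> n) sequentially"
    by (intro eventually_conj)
  from frequently_eventually_conj[OF freq this]
  obtain n where n: "ereal r' < inverse (ereal (real n * infdist (real n * \<alpha>) \<int>))"
    "skew * (1 / (r' * real n))\<^sup>2 < 1 / r - 1 / r'"
    "exp (2 * T) * ?a\<^sup>2 / (r' * real n) + skew / (r' * real n) < real n" "1 \<le> n"
    by (auto dest!: frequently_ex)
  define m where "m = round (real n * \<alpha>)"
  define u where "u = of_int m - of_int (int n) * \<alpha>"
  define v where "v = of_int m *\<^sub>R A + of_int (int n) *\<^sub>R B"
  note pt = lattice_point[of m "int n", folded u_def v_def, simplified]
  have u_eq: "\<bar>u\<bar> = infdist (real n * \<alpha>) \<int>"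
    by (simp add: u_def m_def infdist_Ints_round)
  have u_pos: "0 < \<bar>u\<bar>"
    unfolding u_eq using infdist_irrational_pos[OF irrational, of n] n(4) by simp
  have "r' < inverse (real n * \<bar>u\<bar>)"
    using n(1,4) u_pos by (simp flip: u_eq)
  then have "r' * (real n * \<bar>u\<bar>) < inverse (real n * \<bar>u\<bar>) * (real n * \<bar>u\<bar>)"
    using u_pos n(4) by (intro mult_strict_right_mono) auto
  moreover have "inverse (real n * \<bar>u\<bar>) * (real n * \<bar>u\<bar>) = 1"
    using u_pos n(4) by (intro left_inverse) auto
  ultimately have "r' * (real n * \<bar>u\<bar>) < 1"
    by simp
  then have nu: "real n * \<bar>u\<bar> < 1 / r'" and u_less: "\<bar>u\<bar> < 1 / (r' * real n)"
    using r n(4) by (simp_all add: field_simps)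
  have "u\<^sup>2 \<le> (1 / (r' * real n))\<^sup>2"
    using power_mono[of "\<bar>u\<bar>" _ 2, OF less_imp_le[OF u_less]] by simp
  then have "skew * u\<^sup>2 \<le> skew * (1 / (r' * real n))\<^sup>2"
    by (rule mult_left_mono) (rule skew_nonneg)
  then have product: "\<bar>v $ 1 * v $ 2\<bar> < 1 / r"
    using pt(5) nu n(2) by linarith
  have "exp (2 * T) * (?a * ?a * \<bar>u\<bar>) + skew * \<bar>u\<bar> \<le>
      exp (2 * T) * (?a * ?a * (1 / (r' * real n))) + skew * (1 / (r' * real n))"
    using u_less skew_nonneg by (intro add_mono mult_left_mono) auto
  also have "\<dots> = exp (2 * T) * ?a\<^sup>2 / (r' * real n) + skew / (r' * real n)"
    by (simp add: power2_eq_square)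
  finally have "exp (2 * T) * (?a * ?a * \<bar>u\<bar>) + skew * \<bar>u\<bar> < real n"
    using n(3) by linarith
  then have "?a * (exp (2 * T) * \<bar>v $ 1\<bar>) < ?a * \<bar>v $ 2\<bar>"
    using abs_le_D2[OF pt(2)] unfolding pt(1) by (simp only: mult_ac)
  then have v2: "exp (2 * T) * \<bar>v $ 1\<bar> < \<bar>v $ 2\<bar>"
    using a by simp
  have v1: "0 < \<bar>v $ 1\<bar>"
    using u_pos a by (simp add: pt(1))
  have v2_pos: "0 < \<bar>v $ 2\<bar>"
    using v2 mult_pos_pos[OF exp_gt_zero v1, of "2 * T"] by linarith
  have "exp (2 * T) < \<bar>v $ 2\<bar> / \<bar>v $ 1\<bar>"
    using v1 v2 by (simp only: pos_less_divide_eq)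
  then have "ln (exp (2 * T)) < ln (\<bar>v $ 2\<bar> / \<bar>v $ 1\<bar>)"
    by (subst ln_less_cancel_iff) (use v1 v2_pos in auto)
  then have "T < ln (\<bar>v $ 2\<bar> / \<bar>v $ 1\<bar>) / 2"
    by simp
  moreover have "sq_sys \<Lambda> (ln (\<bar>v $ 2\<bar> / \<bar>v $ 1\<bar>) / 2) < 1 / r"
    using sq_sys_le_product[OF unimodular pt(3)] v1 v2_pos product by auto
  then have "r < inverse (sq_sys \<Lambda> (ln (\<bar>v $ 2\<bar> / \<bar>v $ 1\<bar>) / 2))"
    using sq_sys_pos[OF unimodular] r(1) by (simp add: field_simps)
  ultimately show "\<exists>t>T. ereal r < ereal (inverse (sq_sys \<Lambda> t))"
    unfolding ereal_less_eq less_ereal.simps(1) by blast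
qed

text \<open>A short vector at a large time has a tiny first coordinate, so it comes from a
  fraction \<open>m/n\<close> close to \<open>\<alpha>\<close>. Its denominator is large since the irrational number \<open>\<alpha>\<close> stays away
  from fractions with bounded denominators.\<close>

lemma frequently_approx_if_small_sys:
  assumes r: "0 < r" "r < r'"
    and freq: "\<exists>\<^sub>F t in at_top. ereal r' < ereal (inverse (sq_sys \<Lambda> t))"
  shows "\<exists>\<^sub>F n in sequentially. ereal r < inverse (ereal (real n * infdist (real n * \<alpha>) \<int>))"
  unfolding frequently_sequentially
proof
  fix N :: nat
  have "1 / r' < 1 / r" using r by (simp add: frac_less2)
  obtain \<delta>0 where \<delta>0: "\<delta>0 > 0" "\<And>n. 0 < n \<Longrightarrow> n \<le> N \<Longrightarrow> \<delta>0 \<le> infdist (real n * \<alpha>) \<int>"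
    using infdist_irrational_lower_bound[OF irrational, of N] by blast
  let ?\<delta> = "\<lambda>t. sqrt (1 / r') * exp (- t) / \<bar>A $ 1\<bar>"
  have "(?\<delta> \<longlongrightarrow> sqrt (1 / r') * 0 / \<bar>A $ 1\<bar>) at_top"
    using A1 by (intro tendsto_intros filterlim_compose[OF exp_at_bot] filterlim_uminus_at_bot_at_top) auto
  then have \<delta>_lim: "(?\<delta> \<longlongrightarrow> 0) at_top"
    by simp
  have "((\<lambda>t. skew * (?\<delta> t)\<^sup>2) \<longlongrightarrow> skew * 0\<^sup>2) at_top"
    by (intro tendsto_intros \<delta>_lim)
  then have "eventually (\<lambda>t. skew * (?\<delta> t)\<^sup>2 < 1 / r - 1 / r') at_top"
    using \<open>1 / r' < 1 / r\<close> by (intro order_tendstoD(2)) auto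
  moreover have "eventually (\<lambda>t. ?\<delta> t < min 1 \<delta>0) at_top"
    using \<delta>0(1) by (intro order_tendstoD(2)[OF \<delta>_lim]) auto
  ultimately have "eventually (\<lambda>t. skew * (?\<delta> t)\<^sup>2 < 1 / r - 1 / r' \<and> ?\<delta> t < min 1 \<delta>0) at_top"
    by (rule eventually_conj)
  from frequently_eventually_conj[OF freq this]
  obtain t \<delta> where t: "r' < inverse (sq_sys \<Lambda> t)" "skew * \<delta>\<^sup>2 < 1 / r - 1 / r'" "\<delta> < min 1 \<delta>0"
    and \<delta>: "\<delta> = ?\<delta> t"
    by (auto dest!: frequently_ex)
  have "\<not> 1 / r' \<le> sq_sys \<Lambda> t"
    using t(1) r sq_sys_pos[OF unimodular, of t] by (simp add: field_simps)
  then obtain v where v: "v \<in> \<Lambda>" "v \<noteq> 0" "\<bar>v $ 1\<bar> < sqrt (1 / r') * exp (- t)" "\<bar>v $ 2\<bar> < sqrt (1 / r') * exp t"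
    using r by (auto simp: le_sq_sys_iff[OF unimodular] avoids_box_def not_le)
  obtain m n where mn: "v = of_int m *\<^sub>R A + of_int n *\<^sub>R B"
    using v(1) by (rule lattice_pointE)
  define u where "u = of_int m - of_int n * \<alpha>"
  note pt = lattice_point[of m n, folded u_def mn]
  have "\<bar>v $ 1\<bar> * \<bar>v $ 2\<bar> < (sqrt (1 / r') * exp (- t)) * (sqrt (1 / r') * exp t)"
    using v by (intro mult_strict_mono') auto
  also have "\<dots> = 1 / r'"
    using r by (simp add: exp_minus field_simps)
  finally have product: "\<bar>v $ 1 * v $ 2\<bar> < 1 / r'"
    by (simp add: abs_mult)
  have u_less: "\<bar>u\<bar> < \<delta>"
    unfolding \<delta> using v(3) A1 by (simp add: pt(1) field_simps)
  have "n \<noteq> 0"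
  proof
    assume "n = 0"
    then have "\<bar>of_int m :: real\<bar> < 1"
      using u_less t(3) by (simp add: u_def)
    then have "m = 0"
      by linarith
    then show False
      using \<open>n = 0\<close> pt(4) v(2) by simp
  qed
  have le_u: "infdist (real (nat \<bar>n\<bar>) * \<alpha>) \<int> \<le> \<bar>u\<bar>"
    unfolding u_def by (rule infdist_nat_abs_le)
  have "N \<le> nat \<bar>n\<bar>"
  proof (rule ccontr)
    assume "\<not> N \<le> nat \<bar>n\<bar>"
    then have "\<delta>0 \<le> infdist (real (nat \<bar>n\<bar>) * \<alpha>) \<int>"
      using \<open>n \<noteq> 0\<close> by (intro \<delta>0) auto
    then show False
      using le_u u_less t(3) by linarith
  qed
  moreover have "real (nat \<bar>n\<bar>) * infdist (real (nat \<bar>n\<bar>) * \<alpha>) \<int> < 1 / r"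
  proof -
    have "u\<^sup>2 \<le> \<delta>\<^sup>2"
      using power_mono[of "\<bar>u\<bar>" _ 2, OF less_imp_le[OF u_less]] by simp
    then have "skew * u\<^sup>2 \<le> skew * \<delta>\<^sup>2"
      by (rule mult_left_mono) (rule skew_nonneg)
    moreover have "real (nat \<bar>n\<bar>) * infdist (real (nat \<bar>n\<bar>) * \<alpha>) \<int> \<le> \<bar>of_int n\<bar> * \<bar>u\<bar>"
      using le_u mult_left_mono[OF le_u, of "\<bar>of_int n\<bar>"] by simp
    ultimately show ?thesis
      using abs_le_D2[OF pt(5)] product t(2) by linarith
  qed
  moreover have "0 < real (nat \<bar>n\<bar>) * infdist (real (nat \<bar>n\<bar>) * \<alpha>) \<int>"
    using \<open>n \<noteq> 0\<close> infdist_irrational_pos[OF irrational, of "nat \<bar>n\<bar>"] by simp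
  ultimately show "\<exists>n\<ge>N. ereal r < inverse (ereal (real n * infdist (real n * \<alpha>) \<int>))"
    using less_inverse_ereal[OF r(1)] by blast
qed

lemma Limsup_inverse_sq_sys_at_top:
  "Limsup at_top (\<lambda>t. ereal (inverse (sq_sys \<Lambda> t))) = lagrange_const \<alpha>"
  unfolding lagrange_const_def
proof (rule antisym; rule Limsup_le_Limsup_of_frequently)
  show "0 \<le> inverse (ereal (real n * infdist (real n * \<alpha>) \<int>))" for n
    using infdist_nonneg[of "real n * \<alpha>" \<int>] by (intro ereal_inverse_nonneg_iff[THEN iffD2]) simp
  show "0 \<le> ereal (inverse (sq_sys \<Lambda> t))" for t
    using sq_sys_pos[OF unimodular, of t] by simp
qed (simp_all only: frequently_small_sys_if_approx frequently_approx_if_small_sys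
  sequentially_bot trivial_limit_at_top_linorder not_False_eq_True)

end

section \<open>The Dirichlet constant as a limit along the flow\<close>

context slope_basis
begin

definition "min_error T = Inf {\<bar>of_int q * \<alpha> - of_int p\<bar> | p q :: int. 0 < q \<and> q \<le> int T}"

lemma le_min_error_iff:
  assumes "1 \<le> T"
  shows "x \<le> min_error T \<longleftrightarrow> (\<forall>p q :: int. 0 < q \<longrightarrow> q \<le> int T \<longrightarrow> x \<le> \<bar>of_int p - of_int q * \<alpha>\<bar>)"
proof -
  let ?S = "{\<bar>of_int q * \<alpha> - of_int p\<bar> | p q :: int. 0 < q \<and> q \<le> int T}"
  have "(0 :: int) < 1 \<and> 1 \<le> int T"
    using assms by simp
  then have "?S \<noteq> {}"
    by blast
  moreover have "bdd_below ?S"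
    by (rule bdd_belowI[of _ 0]) auto
  ultimately have "x \<le> min_error T \<longleftrightarrow> (\<forall>y\<in>?S. x \<le> y)"
    unfolding min_error_def by (rule le_cInf_iff)
  also have "\<dots> \<longleftrightarrow> (\<forall>p q :: int. 0 < q \<longrightarrow> q \<le> int T \<longrightarrow> x \<le> \<bar>of_int q * \<alpha> - of_int p\<bar>)"
    by blast
  finally show ?thesis
    by (simp add: abs_minus_commute)
qed

lemma min_error_nonneg: "0 \<le> real T * min_error T"
proof (cases "T = 0")
  case False
  then have "0 \<le> min_error T"
    by (subst le_min_error_iff) auto
  then show ?thesis by simp
qed simp

text \<open>A large systole is a large empty box, flat in the first direction. Its half sides
  \<open>\<bar>A\<^sub>1\<bar>\<delta>\<close> and \<open>H\<close> translate into the absence of approximations with error below \<open>\<delta>\<close> and denominator up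
  to about \<open>\<bar>A\<^sub>1\<bar> H\<close>.\<close>

lemma frequently_large_min_error_if_large_sys:
  assumes r: "0 < r" "r < r'"
    and freq: "\<exists>\<^sub>F t in at_top. ereal r' < ereal (sq_sys \<Lambda> t)"
  shows "\<exists>\<^sub>F T in sequentially. ereal r < ereal (real T * min_error T)"
  unfolding frequently_sequentially
proof
  fix N :: nat
  let ?a = "\<bar>A $ 1\<bar>"
  let ?\<delta> = "\<lambda>t. sqrt r' * exp (- t) / ?a" and ?H = "\<lambda>t. sqrt r' * exp t"
  have a: "0 < ?a" and root: "0 < sqrt r'"
    using A1 r by auto
  have "(?\<delta> \<longlongrightarrow> sqrt r' * 0 / ?a) at_top"
    using A1 by (intro tendsto_intros filterlim_compose[OF exp_at_bot] filterlim_uminus_at_bot_at_top) auto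
  then have \<delta>_lim: "(?\<delta> \<longlongrightarrow> 0) at_top"
    by simp
  then have "((\<lambda>t. skew * (?\<delta> t)\<^sup>2 + 2 * ?\<delta> t) \<longlongrightarrow> skew * 0\<^sup>2 + 2 * 0) at_top"
    by (intro tendsto_intros)
  then have "eventually (\<lambda>t. skew * (?\<delta> t)\<^sup>2 + 2 * ?\<delta> t < r' - r) at_top"
    using r by (intro order_tendstoD(2)) auto
  moreover have "eventually (\<lambda>t. ?\<delta> t < 1) at_top"
    by (intro order_tendstoD(2)[OF \<delta>_lim]) auto
  moreover have "eventually (\<lambda>t. (real N + 3 + skew) / (?a * sqrt r') < exp t) at_top"
    using exp_at_top by (simp add: filterlim_at_top_dense)
  ultimately have "eventually (\<lambda>t. skew * (?\<delta> t)\<^sup>2 + 2 * ?\<delta> t < r' - r \<and> ?\<delta> t < 1 \<and>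
      (real N + 3 + skew) / (?a * sqrt r') < exp t) at_top"
    by (intro eventually_conj)
  from frequently_eventually_conj[OF freq this]
  obtain t \<delta> H where t: "r' < sq_sys \<Lambda> t" "skew * \<delta>\<^sup>2 + 2 * \<delta> < r' - r" "\<delta> < 1"
    "(real N + 3 + skew) / (?a * sqrt r') < exp t"
    and \<delta>: "\<delta> = ?\<delta> t" and H: "H = ?H t"
    by (auto dest!: frequently_ex)
  have \<delta>_pos: "0 < \<delta>"
    using a root by (simp add: \<delta>)
  have H_large: "real N + 3 + skew < ?a * H"
    using t(4) a root by (simp add: H field_simps)
  have aH\<delta>: "?a * H * \<delta> = r'"
    using a r by (simp add: H \<delta> exp_minus field_simps)
  have box: "avoids_box \<Lambda> (?a * \<delta>) H"
    using le_sq_sys_iff[OF unimodular, of r' t] t(1) r a by (simp add: H \<delta>)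
  \<comment> \<open>The largest denominator that the box controls; subtracting \<open>1\<close> makes the upper bound strict. The rounding
    costs at most \<open>2\<delta>\<close> in the product \<open>T \<delta>\<close>.\<close>
  define T where "T = nat (\<lfloor>?a * H - skew * \<delta>\<rfloor> - 1)"
  have "skew * \<delta> \<le> skew"
    using t(3) skew_nonneg mult_left_mono[of \<delta> 1 skew] by simp
  then have T: "real T < ?a * H - skew * \<delta>" "?a * H - skew * \<delta> - 2 < real T"
    using H_large unfolding T_def by linarith+
  have "N \<le> T" "1 \<le> T"
    using T(2) H_large \<open>skew * \<delta> \<le> skew\<close> by linarith+
  have "\<delta> \<le> min_error T"
    unfolding le_min_error_iff[OF \<open>1 \<le> T\<close>]
  proof (intro allI impI, rule ccontr)
    fix p q :: int
    assume q: "0 < q" "q \<le> int T" and less: "\<not> \<delta> \<le> \<bar>of_int p - of_int q * \<alpha>\<bar>"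
    define u where "u = of_int p - of_int q * \<alpha>"
    define v where "v = of_int p *\<^sub>R A + of_int q *\<^sub>R B"
    note pt = lattice_point[of p q, folded u_def v_def]
    have u: "\<bar>u\<bar> < \<delta>"
      using less by (simp add: u_def)
    have "\<bar>v $ 1\<bar> < ?a * \<delta>"
      unfolding pt(1) using a u by simp
    moreover have "\<bar>v $ 2\<bar> < H"
    proof -
      have "?a * \<bar>v $ 2\<bar> \<le> skew * \<bar>u\<bar> + \<bar>of_int q\<bar>"
        using abs_le_D1[OF pt(2)] by simp
      also have "\<dots> \<le> skew * \<delta> + real T"
        using u q skew_nonneg by (intro add_mono mult_left_mono) auto
      also have "\<dots> < ?a * H"
        using T(1) by simp
      finally show ?thesis
        using a by simp
    qed
    moreover have "v \<noteq> 0"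
      using pt(4) q by simp
    ultimately show False
      using box pt(3) unfolding avoids_box_def by (meson not_less)
  qed
  then have "real T * \<delta> \<le> real T * min_error T"
    by (rule mult_left_mono) simp
  moreover have "(?a * H - skew * \<delta> - 2) * \<delta> \<le> real T * \<delta>"
    using T(2) \<delta>_pos by (intro mult_right_mono) auto
  moreover have "(?a * H - skew * \<delta> - 2) * \<delta> = r' - (skew * \<delta>\<^sup>2 + 2 * \<delta>)"
    unfolding aH\<delta>[symmetric] by (simp add: power2_eq_square algebra_simps)
  ultimately have "r < real T * min_error T"
    using t(2) by linarith
  then show "\<exists>T\<ge>N. ereal r < ereal (real T * min_error T)"
    using \<open>N \<le> T\<close> by auto
qed

text \<open>Conversely, if no denominator up to \<open>T\<close> has error below \<open>\<delta>\<close>, then the box with half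
  sides \<open>\<bar>A\<^sub>1\<bar>\<delta>\<close> and about \<open>T/\<bar>A\<^sub>1\<bar>\<close> is empty. Dirichlet's theorem gives \<open>\<delta> < 1/T\<close>; therefore the box becomes
  flat as \<open>T\<close> grows, which makes the time large.\<close>

lemma frequently_large_sys_if_large_min_error:
  assumes r: "0 < r" "r < r'"
    and freq: "\<exists>\<^sub>F T in sequentially. ereal r' < ereal (real T * min_error T)"
  shows "\<exists>\<^sub>F t in at_top. ereal r < ereal (sq_sys \<Lambda> t)"
  unfolding frequently_at_top_real
proof
  fix \<tau> :: real
  let ?a = "\<bar>A $ 1\<bar>"
  have a: "0 < ?a"
    using A1 by auto
  have "eventually (\<lambda>T. c < real T) sequentially" for c
    using filterlim_real_sequentially by (simp add: filterlim_at_top_dense)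
  then have "eventually (\<lambda>T. skew / (r' - r) < real T \<and> skew + exp (2 * \<tau>) * ?a\<^sup>2 < real T) sequentially"
    by (intro eventually_conj)
  from frequently_eventually_conj[OF freq this]
  obtain T where T: "r' < real T * min_error T" "skew / (r' - r) < real T" "skew + exp (2 * \<tau>) * ?a\<^sup>2 < real T"
    by (auto dest!: frequently_ex)
  define \<delta> where "\<delta> = min_error T"
  have "0 < real T"
    using T(3) skew_nonneg by (smt (verit) exp_gt_zero mult_nonneg_nonneg zero_le_power2)
  then have "1 \<le> T" by simp
  have \<delta>_pos: "0 < \<delta>"
    using T(1) r \<open>0 < real T\<close> unfolding \<delta>_def by (smt (verit) mult_nonneg_nonpos)
  obtain h k where hk: "0 < k" "k \<le> int T" "\<bar>of_int k * \<alpha> - of_int h\<bar> < 1 / T"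
    using \<open>0 < real T\<close> by (metis Dirichlet_approx of_nat_0_less_iff)
  have \<delta>_le: "\<delta> \<le> \<bar>of_int p - of_int q * \<alpha>\<bar>" if "0 < q" "q \<le> int T" for p q
    using le_min_error_iff[OF \<open>1 \<le> T\<close>, of \<delta>] that by (auto simp: \<delta>_def)
  have \<delta>_less: "\<delta> < 1 / T"
    using \<delta>_le[OF hk(1,2), of h] hk(3) by (simp add: abs_minus_commute)
  have "1 / real T \<le> 1"
    using \<open>1 \<le> T\<close> by simp
  with \<delta>_less have "\<delta> < 1"
    by linarith
  define X Y where "X = ?a * \<delta>" and "Y = (real T - skew * \<delta>) / ?a"
  have box: "avoids_box \<Lambda> X Y"
    unfolding avoids_box_def
  proof (intro ballI impI, rule ccontr)
    fix v assume v: "v \<in> \<Lambda>" "v \<noteq> 0" and small: "\<not> (X \<le> \<bar>v $ 1\<bar> \<or> Y \<le> \<bar>v $ 2\<bar>)"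
    obtain m n where mn: "v = of_int m *\<^sub>R A + of_int n *\<^sub>R B"
      using v(1) by (rule lattice_pointE)
    define u where "u = of_int m - of_int n * \<alpha>"
    note pt = lattice_point[of m n, folded u_def mn]
    have u: "\<bar>u\<bar> < \<delta>"
      using small a by (simp add: pt(1) X_def)
    have "\<bar>of_int n\<bar> \<le> skew * \<bar>u\<bar> + ?a * \<bar>v $ 2\<bar>"
      using abs_le_D2[OF pt(2)] by simp
    also have "\<dots> \<le> skew * \<delta> + ?a * \<bar>v $ 2\<bar>"
      using u skew_nonneg by (intro add_mono mult_left_mono) auto
    also have "\<dots> < skew * \<delta> + ?a * Y"
      using small a by simp
    also have "\<dots> = real T"
      using a by (simp add: Y_def)
    finally have "\<bar>of_int n\<bar> < real T" .
    then have n: "\<bar>n\<bar> \<le> int T"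
      by linarith
    consider "n = 0" | "0 < n" | "n < 0"
      by linarith
    then show False
    proof cases
      case 1
      then have "\<bar>of_int m :: real\<bar> < 1"
        using u \<open>\<delta> < 1\<close> by (simp add: u_def)
      then have "m = 0"
        by linarith
      then show False
        using 1 pt(4) v(2) by simp
    next
      case 2
      then show False
        using \<delta>_le[of n m] n u by (simp add: u_def)
    next
      case 3
      then show False
        using \<delta>_le[of "- n" "- m"] n u by (simp add: u_def)
    qed
  qed
  have "(skew + exp (2 * \<tau>) * ?a\<^sup>2) * \<delta> \<le> (skew + exp (2 * \<tau>) * ?a\<^sup>2) * 1"
    using \<open>\<delta> < 1\<close> skew_nonneg by (intro mult_left_mono) auto
  then have "exp (2 * \<tau>) * ?a\<^sup>2 * \<delta> < real T - skew * \<delta>"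
    using T(3) by (simp add: distrib_right)
  then have ratio: "exp (2 * \<tau>) * X < Y"
    using a by (simp add: X_def Y_def power2_eq_square field_simps)
  have "0 < X"
    using a \<delta>_pos by (simp add: X_def)
  then have "0 < Y"
    using ratio mult_pos_pos[OF exp_gt_zero \<open>0 < X\<close>, of "2 * \<tau>"] by linarith
  have "exp (2 * \<tau>) < Y / X"
    using ratio \<open>0 < X\<close> by (simp only: pos_less_divide_eq)
  then have "ln (exp (2 * \<tau>)) < ln (Y / X)"
    by (subst ln_less_cancel_iff) (use \<open>0 < X\<close> \<open>0 < Y\<close> in auto)
  then have "\<tau> < ln (Y / X) / 2"
    by simp
  moreover have "r < X * Y"
  proof -
    have "skew * \<delta>\<^sup>2 \<le> skew * \<delta>"
      using \<open>\<delta> < 1\<close> \<delta>_pos skew_nonneg by (intro mult_left_mono) (auto simp: power2_eq_square)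
    also have "\<dots> \<le> skew * (1 / T)"
      using \<delta>_less skew_nonneg by (intro mult_left_mono) auto
    also have "\<dots> < r' - r"
      using T(2) r \<open>0 < real T\<close> by (simp add: field_simps)
    finally have "r < real T * \<delta> - skew * \<delta>\<^sup>2"
      using T(1) by (simp add: \<delta>_def)
    also have "\<dots> = X * Y"
      using a by (simp add: X_def Y_def power2_eq_square field_simps)
    finally show ?thesis .
  qed
  moreover have "X * Y \<le> sq_sys \<Lambda> (ln (Y / X) / 2)"
    by (rule avoids_box_imp_le_sq_sys[OF unimodular \<open>0 < X\<close> \<open>0 < Y\<close> box])
  ultimately show "\<exists>t>\<tau>. ereal r < ereal (sq_sys \<Lambda> t)"
    by (intro exI[of _ "ln (Y / X) / 2"]) simp
qed

lemma Limsup_sq_sys_at_top: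
  "Limsup at_top (\<lambda>t. ereal (sq_sys \<Lambda> t)) = dirichlet_const \<alpha>"
  unfolding dirichlet_const_def min_error_def[symmetric]
proof (rule antisym; rule Limsup_le_Limsup_of_frequently)
  show "0 \<le> ereal (real T * min_error T)" for T
    using min_error_nonneg[of T] by simp
  show "0 \<le> ereal (sq_sys \<Lambda> t)" for t
    using sq_sys_pos[OF unimodular, of t] by simp
qed (simp_all only: frequently_large_min_error_if_large_sys frequently_large_sys_if_large_min_error
  sequentially_bot trivial_limit_at_top_linorder not_False_eq_True)

end

section \<open>Both ends of the flow\<close>

definition swap :: "real^2 \<Rightarrow> real^2" where "swap v = vector [v $ 2, v $ 1]"

lemma swap_nth [simp]: "swap v $ 1 = v $ 2" "swap v $ 2 = v $ 1"
  by (simp_all add: swap_def vector_2)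

lemma swap_lattice_of: "swap ` lattice_of A B = lattice_of (swap A) (swap B)"
proof -
  have "swap (of_int m *\<^sub>R A + of_int n *\<^sub>R B) = of_int m *\<^sub>R swap A + of_int n *\<^sub>R swap B" for m n :: int
    by (simp add: vec_eq_iff forall_2)
  then show ?thesis
    unfolding lattice_of_def by (auto simp: image_iff) metis+
qed

lemma unimodular_swap:
  assumes "unimodular_lattice \<Lambda>" shows "unimodular_lattice (swap ` \<Lambda>)"
proof -
  obtain A B where AB: "\<Lambda> = lattice_of A B" "\<bar>A $ 1 * B $ 2 - A $ 2 * B $ 1\<bar> = 1"
    using assms by (rule unimodular_latticeE)
  then show ?thesis
    unfolding AB(1) swap_lattice_of by (intro unimodular_latticeI) (simp add: abs_minus_commute)
qed

lemma avoids_box_swap: "avoids_box (swap ` \<Lambda>) X Y \<longleftrightarrow> avoids_box \<Lambda> Y X"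
  by (auto simp: avoids_box_def vec2_eq_0_iff)

lemma bi_infinite_swap: "bi_infinite \<Lambda> \<Longrightarrow> bi_infinite (swap ` \<Lambda>)"
  by (auto simp: bi_infinite_def vec2_eq_0_iff)

text \<open>Exchanging the coordinates conjugates \<open>g\<^sub>t\<close> to \<open>g\<^sub>-\<^sub>t\<close>.\<close>

lemma sq_sys_swap:
  assumes "unimodular_lattice \<Lambda>" shows "sq_sys (swap ` \<Lambda>) t = sq_sys \<Lambda> (- t)"
proof -
  have "c \<le> sq_sys (swap ` \<Lambda>) t \<longleftrightarrow> c \<le> sq_sys \<Lambda> (- t)" if "0 \<le> c" for c
    using that by (simp add: le_sq_sys_iff assms unimodular_swap avoids_box_swap)
  then show ?thesis
    using sq_sys_pos[OF assms, of "- t"] sq_sys_pos[OF unimodular_swap[OF assms], of t]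
    by (metis less_imp_le order.antisym order.refl)
qed

lemma Limsup_at_infinity_sq_sys:
  fixes f :: "real \<Rightarrow> ereal"
  assumes "unimodular_lattice \<Lambda>"
  shows "Limsup at_infinity (\<lambda>t. f (sq_sys \<Lambda> t)) =
    max (Limsup at_top (\<lambda>t. f (sq_sys \<Lambda> t))) (Limsup at_top (\<lambda>t. f (sq_sys (swap ` \<Lambda>) t)))"
  unfolding at_infinity_eq_at_top_bot Limsup_sup_filter at_bot_mirror sq_sys_swap[OF assms]
  by (subst Limsup_filtermap_eq) (auto simp: inj_def)

text \<open>A vanishing first coordinate of \<open>A\<close> or a rational slope would give a nonzero lattice point
  on the second axis.\<close>

lemma bi_infinite_slope_basis:
  assumes "unimodular_lattice \<Lambda>" "bi_infinite \<Lambda>"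
  obtains A B \<alpha> where "slope_basis A B \<alpha> \<Lambda>"
proof -
  obtain A B where AB: "\<Lambda> = lattice_of A B" "\<bar>A $ 1 * B $ 2 - A $ 2 * B $ 1\<bar> = 1"
    using assms by (auto elim: unimodular_latticeE)
  have nz: "v $ 1 \<noteq> 0" if "v = of_int m *\<^sub>R A + of_int n *\<^sub>R B" "m \<noteq> 0 \<or> n \<noteq> 0" for v and m n :: int
    using assms(2) that lattice_comb_eq_0_iff[OF AB(2), of m n] lattice_ofI[of m A n B]
    by (auto simp: bi_infinite_def AB(1))
  have A1: "A $ 1 \<noteq> 0"
    using nz[of A 1 0] by simp
  have "- B $ 1 / A $ 1 \<notin> \<rat>"
  proof
    assume "- B $ 1 / A $ 1 \<in> \<rat>"
    then obtain m n :: int where mn: "n \<noteq> 0" "- B $ 1 / A $ 1 = of_int m / of_int n"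
      by (metis Rats_cases' less_irrefl)
    then show False
      using nz[of "of_int m *\<^sub>R A + of_int n *\<^sub>R B" m n] A1 by (simp add: field_simps)
  qed
  then show thesis
    using that[of A B "- B $ 1 / A $ 1"] AB A1 by (simp add: slope_basis_def)
qed

lemma Limsup_at_infinity_eq_slope_consts:
  assumes "unimodular_lattice \<Lambda>" "bi_infinite \<Lambda>"
  obtains \<alpha> \<beta> where "\<alpha> \<notin> \<rat>" "\<beta> \<notin> \<rat>"
    "Limsup at_infinity (\<lambda>t. ereal (inverse (sq_sys \<Lambda> t))) = max (lagrange_const \<alpha>) (lagrange_const \<beta>)"
    "Limsup at_infinity (\<lambda>t. ereal (sq_sys \<Lambda> t)) = max (dirichlet_const \<alpha>) (dirichlet_const \<beta>)"
proof -
  obtain A B \<alpha> where \<alpha>: "slope_basis A B \<alpha> \<Lambda>"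
    using assms by (rule bi_infinite_slope_basis)
  obtain A' B' \<beta> where \<beta>: "slope_basis A' B' \<beta> (swap ` \<Lambda>)"
    using bi_infinite_slope_basis[OF unimodular_swap bi_infinite_swap] assms by metis
  show ?thesis
  proof
    show "\<alpha> \<notin> \<rat>" "\<beta> \<notin> \<rat>"
      using \<alpha> \<beta> by (auto simp: slope_basis_def)
    show "Limsup at_infinity (\<lambda>t. ereal (inverse (sq_sys \<Lambda> t))) = max (lagrange_const \<alpha>) (lagrange_const \<beta>)"
      using Limsup_at_infinity_sq_sys[OF assms(1), of "\<lambda>s. ereal (inverse s)"]
        slope_basis.Limsup_inverse_sq_sys_at_top[OF \<alpha>] slope_basis.Limsup_inverse_sq_sys_at_top[OF \<beta>] by simp
    show "Limsup at_infinity (\<lambda>t. ereal (sq_sys \<Lambda> t)) = max (dirichlet_const \<alpha>) (dirichlet_const \<beta>)"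
      using Limsup_at_infinity_sq_sys[OF assms(1), of ereal]
        slope_basis.Limsup_sq_sys_at_top[OF \<alpha>] slope_basis.Limsup_sq_sys_at_top[OF \<beta>] by simp
  qed
qed

lemma lattice_of_add: "lattice_of A (A + B) = lattice_of A B"
proof
  have "of_int m *\<^sub>R A + of_int n *\<^sub>R (A + B) = of_int (m + n) *\<^sub>R A + of_int n *\<^sub>R B" for m n :: int
    by (simp add: algebra_simps)
  then show "lattice_of A (A + B) \<subseteq> lattice_of A B"
    unfolding lattice_of_def by blast
  have "of_int m *\<^sub>R A + of_int n *\<^sub>R B = of_int (m - n) *\<^sub>R A + of_int n *\<^sub>R (A + B)" for m n :: int
    by (simp add: algebra_simps)
  then show "lattice_of A B \<subseteq> lattice_of A (A + B)"
    unfolding lattice_of_def by blast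
qed

text \<open>In the basis \<open>(1, 1)\<close>, \<open>(-\<alpha>, -\<alpha> - 1)\<close> the first coordinate has slope \<open>\<alpha>\<close> and the second one
  slope \<open>\<alpha> + 1\<close>. Adding the first basis vector to the second one lowers the latter slope to \<open>\<alpha>\<close>, so
  both ends of the flow have the same limits.\<close>

lemma bi_infinite_lattice_of_irrational:
  assumes "\<alpha> \<notin> \<rat>"
  obtains \<Lambda> where "unimodular_lattice \<Lambda>" "bi_infinite \<Lambda>"
    "Limsup at_infinity (\<lambda>t. ereal (inverse (sq_sys \<Lambda> t))) = lagrange_const \<alpha>"
    "Limsup at_infinity (\<lambda>t. ereal (sq_sys \<Lambda> t)) = dirichlet_const \<alpha>"
proof -
  define A B :: "real^2" where "A = vector [1, 1]" and "B = vector [- \<alpha>, - \<alpha> - 1]"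
  define \<Lambda> where "\<Lambda> = lattice_of A B"
  have A: "A $ 1 = 1" "A $ 2 = 1" and B: "B $ 1 = - \<alpha>" "B $ 2 = - \<alpha> - 1"
    by (simp_all add: A_def B_def vector_2)
  have 1: "slope_basis A B \<alpha> \<Lambda>"
    using assms by (auto simp: slope_basis_def A B \<Lambda>_def)
  have "swap A = A"
    by (simp add: vec_eq_iff forall_2 A)
  then have "swap ` \<Lambda> = lattice_of A (A + swap B)"
    unfolding \<Lambda>_def swap_lattice_of lattice_of_add by simp
  then have 2: "slope_basis A (A + swap B) \<alpha> (swap ` \<Lambda>)"
    using assms by (auto simp: slope_basis_def A B)
  have uni: "unimodular_lattice \<Lambda>"
    by (rule slope_basis.unimodular[OF 1])
  show ?thesis
  proof
    show "unimodular_lattice \<Lambda>" by fact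
    show "bi_infinite \<Lambda>"
      unfolding bi_infinite_def
    proof (intro ballI impI)
      fix v assume v: "v \<in> \<Lambda>" "v $ 1 = 0 \<or> v $ 2 = 0"
      obtain m n :: int where mn: "v $ 1 = of_int m * A $ 1 + of_int n * B $ 1"
        "v $ 2 = of_int m * A $ 2 + of_int n * B $ 2"
        using v(1) unfolding \<Lambda>_def by (rule lattice_ofE)
      have "of_int m - of_int n * \<alpha> = 0 \<or> of_int (m - n) - of_int n * \<alpha> = 0"
        using v(2) mn by (auto simp: A B algebra_simps)
      then have "n = 0"
        using irrational_approx_ne_0[OF assms, of n] by blast
      then show "v = 0"
        using v(2) mn by (auto simp: vec2_eq_0_iff A)
    qed
    show "Limsup at_infinity (\<lambda>t. ereal (inverse (sq_sys \<Lambda> t))) = lagrange_const \<alpha>"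
      using Limsup_at_infinity_sq_sys[OF uni, of "\<lambda>s. ereal (inverse s)"]
        slope_basis.Limsup_inverse_sq_sys_at_top[OF 1] slope_basis.Limsup_inverse_sq_sys_at_top[OF 2] by simp
    show "Limsup at_infinity (\<lambda>t. ereal (sq_sys \<Lambda> t)) = dirichlet_const \<alpha>"
      using Limsup_at_infinity_sq_sys[OF uni, of ereal]
        slope_basis.Limsup_sq_sys_at_top[OF 1] slope_basis.Limsup_sq_sys_at_top[OF 2] by simp
  qed
qed

text \<open>Baire's theorem: for each \<open>k\<close> the numbers with an approximation \<open>m/n\<close>, \<open>n > k\<close>, such that
  \<open>n \<bar>m - n\<alpha>\<bar> < 1/(k + 1)\<close> form an open set that contains all rationals and is therefore dense, so
  some irrational number lies in all of these sets.\<close>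

lemma ex_lagrange_const_infinite: "\<exists>\<alpha>. \<alpha> \<notin> \<rat> \<and> lagrange_const \<alpha> = \<infinity>"
proof -
  define U where "U k = (\<Union>n\<in>{Suc k..}. \<Union>m :: int. {\<alpha> :: real. real n * \<bar>of_int m - real n * \<alpha>\<bar> < 1 / real (Suc k)})" for k
  have open_U: "open (U k)" for k
    unfolding U_def by (intro open_UN ballI open_Collect_less continuous_intros)
  have "\<rat> \<subseteq> U k" for k
  proof
    fix x :: real assume "x \<in> \<rat>"
    then obtain p q :: int where pq: "q > 0" "x = of_int p / of_int q"
      by (rule Rats_cases')
    \<comment> \<open>The fraction \<open>p/q\<close> is expanded to make its denominator large.\<close>
    define n where "n = nat q * Suc k"
    have "Suc k \<le> n"
      using pq(1) by (simp add: n_def del: mult_Suc_right)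
    moreover have "of_int (p * int (Suc k)) - real n * x = 0"
      using pq by (simp add: n_def field_simps)
    ultimately show "x \<in> U k"
      unfolding U_def by (intro UN_I[of n] UN_I[of "p * int (Suc k)"]) auto
  qed
  then have dense_U: "closure (U k) = UNIV" for k
    using closure_mono[of \<rat> "U k"] Rats_closure_real by (auto simp: top.extremum_unique)
  have "(UNIV :: real set) \<subseteq> closure (\<Inter>(range U \<union> (\<lambda>r. - {r}) ` \<rat>))"
  proof (rule Baire)
    show "countable (range U \<union> (\<lambda>r. - {r :: real}) ` \<rat>)"
      by (simp add: countable_rat)
    show "openin (top_of_set UNIV) T \<and> UNIV \<subseteq> closure T"
      if "T \<in> range U \<union> (\<lambda>r. - {r :: real}) ` \<rat>" for T
      using that open_U dense_U by (auto simp: closure_complement)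
  qed simp
  then have "\<Inter>(range U \<union> (\<lambda>r. - {r}) ` \<rat>) \<noteq> {}"
    by (metis UNIV_not_empty closure_empty subset_empty)
  then obtain \<alpha> where \<alpha>: "\<alpha> \<in> \<Inter>(range U \<union> (\<lambda>r. - {r}) ` \<rat>)"
    by blast
  then have in_U: "\<alpha> \<in> U k" for k
    by blast
  have irrational: "\<alpha> \<notin> \<rat>"
    using \<alpha> by blast
  have "ereal r \<le> lagrange_const \<alpha>" for r
  proof (rule ccontr)
    assume "\<not> ereal r \<le> lagrange_const \<alpha>"
    then have "eventually (\<lambda>n. inverse (ereal (real n * infdist (real n * \<alpha>) \<int>)) < ereal r) sequentially"
      unfolding lagrange_const_def by (intro Limsup_lessD) simp
    then obtain N where N: "\<And>n. n \<ge> N \<Longrightarrow> inverse (ereal (real n * infdist (real n * \<alpha>) \<int>)) < ereal r"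
      by (auto simp: eventually_sequentially)
    define k where "k = max N (nat \<lceil>r\<rceil>)"
    obtain n m where n: "Suc k \<le> n" "real n * \<bar>of_int m - real n * \<alpha>\<bar> < 1 / real (Suc k)"
      using in_U[of k] by (auto simp: U_def)
    have "real n * infdist (real n * \<alpha>) \<int> \<le> real n * \<bar>of_int m - real n * \<alpha>\<bar>"
      by (intro mult_left_mono infdist_Ints_le) simp
    then have "real n * infdist (real n * \<alpha>) \<int> < 1 / real (Suc k)"
      using n(2) by linarith
    moreover have "0 < real n * infdist (real n * \<alpha>) \<int>"
      using n(1) infdist_irrational_pos[OF irrational, of n] by simp
    ultimately have "ereal (real (Suc k)) < inverse (ereal (real n * infdist (real n * \<alpha>) \<int>))"
      by (intro less_inverse_ereal) auto
    moreover have "inverse (ereal (real n * infdist (real n * \<alpha>) \<int>)) < ereal r"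
      using n(1) by (intro N) (simp add: k_def)
    ultimately have "real (Suc k) < r"
      using less_trans by fastforce
    moreover have "r \<le> real (Suc k)"
      unfolding k_def by linarith
    ultimately show False
      by linarith
  qed
  then have "lagrange_const \<alpha> = \<infinity>"
    by (rule ereal_top)
  with irrational show ?thesis
    by blast
qed

section \<open>Minkowski's theorem for squares\<close>

text \<open>Let \<open>(s, b)\<close> be a shortest vector for the sup norm and \<open>(x, y)\<close> a second lattice
  vector. Subtracting a multiple of the first from the second achieves \<open>0 \<le> x < s\<close>,
  and then \<open>\<bar>y\<bar> \<ge> s\<close> because the second vector is not shorter. If \<open>y\<close> is negative, the two terms of the
  determinant \<open>s y - b x\<close> do not cancel. If \<open>y\<close> is positive and \<open>x > 0\<close>, the same happens after one more
  subtraction, which makes \<open>x\<close> negative and keeps \<open>y \<ge> s\<close>. For \<open>x = 0\<close> the second term vanishes.\<close>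

lemma minimal_vector_det_nonneg:
  fixes s x y b :: real
  assumes "0 < s" "0 \<le> b" "b \<le> s"
    and far: "\<And>k :: int. s \<le> \<bar>x - of_int k * s\<bar> \<or> s \<le> \<bar>y - of_int k * b\<bar>"
  shows "s\<^sup>2 \<le> \<bar>s * y - b * x\<bar>"
proof -
  define k where "k = \<lfloor>x / s\<rfloor>"
  define x' y' where "x' = x - of_int k * s" and "y' = y - of_int k * b"
  have x': "0 \<le> x'" "x' < s"
    using assms(1) floor_divide_lower[of s x] floor_divide_upper[of s x]
    by (simp_all add: x'_def k_def algebra_simps)
  have eq: "s * y - b * x = s * y' - b * x'"
    by (simp add: x'_def y'_def algebra_simps)
  have far0: "s \<le> \<bar>y'\<bar>"
    using far[of k] x' by (simp add: x'_def y'_def)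
  have far1: "s \<le> \<bar>x' - s\<bar> \<or> s \<le> \<bar>y' - b\<bar>"
    using far[of "k + 1"] by (simp add: x'_def y'_def algebra_simps)
  consider "x' = 0" | "y' \<le> - s" | "0 < x'" "s \<le> y'"
    using far0 x'(1) by linarith
  then have "s * s \<le> \<bar>s * y' - b * x'\<bar>"
  proof cases
    case 1
    then show ?thesis
      using far0 assms(1) mult_left_mono[OF far0, of s] by (simp add: abs_mult)
  next
    case 2
    have "s * y' \<le> s * (- s)" "0 \<le> b * x'"
      using mult_left_mono[OF 2, of s] assms(1,2) x'(1) by simp_all
    then show ?thesis
      by simp
  next
    case 3
    then have "s \<le> y' - b"
      using far1 x' assms(3) by linarith
    then have "s * s \<le> s * (y' - b)"
      using assms(1) by (intro mult_left_mono) auto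
    moreover have "0 \<le> b * (s - x')"
      using x' assms(2) by (intro mult_nonneg_nonneg) auto
    ultimately show ?thesis
      by (simp add: algebra_simps)
  qed
  then show ?thesis
    by (simp add: eq power2_eq_square)
qed

lemma minimal_vector_det:
  fixes a b x y :: real
  assumes "0 < \<bar>a\<bar>" "\<bar>b\<bar> \<le> \<bar>a\<bar>"
    and far: "\<And>k :: int. \<bar>a\<bar> \<le> \<bar>x - of_int k * a\<bar> \<or> \<bar>a\<bar> \<le> \<bar>y - of_int k * b\<bar>"
  shows "a\<^sup>2 \<le> \<bar>a * y - b * x\<bar>"
proof -
  have pos: "a\<^sup>2 \<le> \<bar>a * y - b * x\<bar>"
    if "0 < a" "\<bar>b\<bar> \<le> a" and far: "\<And>k :: int. a \<le> \<bar>x - of_int k * a\<bar> \<or> a \<le> \<bar>y - of_int k * b\<bar>"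
    for a b x y :: real
  proof (cases "0 \<le> b")
    case True
    then show ?thesis
      using minimal_vector_det_nonneg[of a b x y] that by auto
  next
    case False
    have "\<bar>- y - of_int k * - b\<bar> = \<bar>y - of_int k * b\<bar>" for k :: int
      by (metis abs_minus_cancel minus_diff_eq mult_minus_right diff_minus_eq_add uminus_add_conv_diff)
    then have "a\<^sup>2 \<le> \<bar>a * (- y) - (- b) * x\<bar>"
      using that False by (intro minimal_vector_det_nonneg) auto
    also have "\<dots> = \<bar>a * y - b * x\<bar>"
      by (simp add: abs_minus_commute)
    finally show ?thesis .
  qed
  show ?thesis
  proof (cases "0 < a")
    case True
    then show ?thesis
      using pos[of a b x y] assms by auto
  next
    case False
    have "- a \<le> \<bar>x - of_int k * - a\<bar> \<or> - a \<le> \<bar>y - of_int k * - b\<bar>" for k :: int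
      using far[of "- k"] False by simp
    then have "(- a)\<^sup>2 \<le> \<bar>- a * y - - b * x\<bar>"
      using False assms by (intro pos) auto
    then show ?thesis
      by (simp add: abs_minus_commute)
  qed
qed

lemma finite_lattice_inter_box:
  assumes "unimodular_lattice \<Lambda>"
  shows "finite {v \<in> \<Lambda>. \<bar>v $ 1\<bar> \<le> R \<and> \<bar>v $ 2\<bar> \<le> R}"
proof -
  obtain A B where AB: "\<Lambda> = lattice_of A B" "\<bar>A $ 1 * B $ 2 - A $ 2 * B $ 1\<bar> = 1"
    using assms by (rule unimodular_latticeE)
  define M where "M = \<lceil>R * (\<bar>A $ 1\<bar> + \<bar>A $ 2\<bar> + \<bar>B $ 1\<bar> + \<bar>B $ 2\<bar>)\<rceil>"
  have "{v \<in> \<Lambda>. \<bar>v $ 1\<bar> \<le> R \<and> \<bar>v $ 2\<bar> \<le> R} \<subseteq>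
      (\<lambda>(m, n). of_int m *\<^sub>R A + of_int n *\<^sub>R B) ` ({- M..M} \<times> {- M..M})"
  proof
    fix v assume "v \<in> {v \<in> \<Lambda>. \<bar>v $ 1\<bar> \<le> R \<and> \<bar>v $ 2\<bar> \<le> R}"
    then have v: "v \<in> \<Lambda>" "\<bar>v $ 1\<bar> \<le> R" "\<bar>v $ 2\<bar> \<le> R"
      by auto
    then obtain m n :: int where mn: "v = of_int m *\<^sub>R A + of_int n *\<^sub>R B"
      by (auto simp: AB(1) lattice_of_def)
    have bound: "\<bar>v $ 1 * b - v $ 2 * a\<bar> \<le> R * (\<bar>a\<bar> + \<bar>b\<bar>)" for a b
    proof -
      have "\<bar>v $ 1 * b - v $ 2 * a\<bar> \<le> \<bar>v $ 1\<bar> * \<bar>b\<bar> + \<bar>v $ 2\<bar> * \<bar>a\<bar>"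
        by (metis abs_mult abs_triangle_ineq4)
      also have "\<dots> \<le> R * \<bar>b\<bar> + R * \<bar>a\<bar>"
        using v by (intro add_mono mult_right_mono) auto
      finally show ?thesis
        by (simp add: algebra_simps)
    qed
    have R: "0 \<le> R"
      using v(2) by linarith
    have "\<bar>of_int m * (A $ 1 * B $ 2 - A $ 2 * B $ 1)\<bar> \<le> R * (\<bar>B $ 1\<bar> + \<bar>B $ 2\<bar>)"
      using bound[of "B $ 2" "B $ 1"] by (simp add: mn algebra_simps)
    moreover have "\<bar>of_int n * (A $ 1 * B $ 2 - A $ 2 * B $ 1)\<bar> \<le> R * (\<bar>A $ 1\<bar> + \<bar>A $ 2\<bar>)"
      using bound[of "A $ 2" "A $ 1"] by (simp add: mn algebra_simps abs_minus_commute)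
    moreover have "0 \<le> R * (\<bar>A $ 1\<bar> + \<bar>A $ 2\<bar>)" "0 \<le> R * (\<bar>B $ 1\<bar> + \<bar>B $ 2\<bar>)"
      using R by simp_all
    ultimately have "\<bar>of_int m\<bar> \<le> R * (\<bar>A $ 1\<bar> + \<bar>A $ 2\<bar> + \<bar>B $ 1\<bar> + \<bar>B $ 2\<bar>)"
      "\<bar>of_int n\<bar> \<le> R * (\<bar>A $ 1\<bar> + \<bar>A $ 2\<bar> + \<bar>B $ 1\<bar> + \<bar>B $ 2\<bar>)"
      unfolding abs_mult AB(2) by (simp_all add: algebra_simps)
    then have "m \<in> {- M..M}" "n \<in> {- M..M}"
      unfolding M_def atLeastAtMost_iff by linarith+
    then show "v \<in> (\<lambda>(m, n). of_int m *\<^sub>R A + of_int n *\<^sub>R B) ` ({- M..M} \<times> {- M..M})"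
      using mn by auto
  qed
  then show ?thesis
    by (rule finite_subset) auto
qed

text \<open>Dividing by the common divisor of the coefficients shortens a vector, and a vector with
  coprime coefficients can be completed to a basis.\<close>

lemma primitive_multiple:
  assumes "v \<in> lattice_of A B" "v \<noteq> 0"
  obtains m n g :: int where "coprime m n" "g \<noteq> 0" "v = of_int g *\<^sub>R (of_int m *\<^sub>R A + of_int n *\<^sub>R B)"
proof -
  obtain m n :: int where mn: "v = of_int m *\<^sub>R A + of_int n *\<^sub>R B"
    using assms(1) by (auto simp: lattice_of_def)
  have nz: "\<not> (m = 0 \<and> n = 0)"
    using mn assms(2) by auto
  then obtain m' n' where "m = gcd m n * m'" "n = gcd m n * n'" "coprime m' n'"
    using gcd_coprime_exists[of m n] by (metis gcd_eq_0_iff mult.commute)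
  then have "v = of_int (gcd m n) *\<^sub>R (of_int m' *\<^sub>R A + of_int n' *\<^sub>R B)"
    using mn by (simp add: scaleR_add_right) (metis of_int_mult)
  moreover have "gcd m n \<noteq> 0"
    using nz by simp
  ultimately show thesis
    using that \<open>coprime m' n'\<close> by blast
qed

lemma sys_flow_attained:
  assumes "unimodular_lattice \<Lambda>"
  obtains v where "v \<in> \<Lambda>" "v \<noteq> 0" "\<And>w. w \<in> \<Lambda> \<Longrightarrow> w \<noteq> 0 \<Longrightarrow> infnorm (diag_flow t *v v) \<le> infnorm (diag_flow t *v w)"
proof -
  let ?N = "\<lambda>v. infnorm (diag_flow t *v v)"
  obtain v0 where v0: "v0 \<in> \<Lambda>" "v0 \<noteq> 0"
    using unimodular_nonzero[OF assms] by blast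
  define S where "S = {v \<in> \<Lambda>. v \<noteq> 0 \<and> ?N v \<le> ?N v0}"
  define R where "R = max (?N v0 * exp (- t)) (?N v0 * exp t)"
  have "S \<subseteq> {v \<in> \<Lambda>. \<bar>v $ 1\<bar> \<le> R \<and> \<bar>v $ 2\<bar> \<le> R}"
  proof
    fix v assume v: "v \<in> S"
    then have "\<bar>(diag_flow t *v v) $ 1\<bar> \<le> ?N v0" "\<bar>(diag_flow t *v v) $ 2\<bar> \<le> ?N v0"
      using component_le_infnorm_cart[of "diag_flow t *v v"]
      by (auto simp: S_def simp del: diag_flow_mult intro: order_trans)
    then have "\<bar>v $ 1\<bar> \<le> ?N v0 * exp (- t)" "\<bar>v $ 2\<bar> \<le> ?N v0 * exp t"
      by (simp_all add: abs_mult exp_minus field_simps)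
    then show "v \<in> {v \<in> \<Lambda>. \<bar>v $ 1\<bar> \<le> R \<and> \<bar>v $ 2\<bar> \<le> R}"
      using v by (auto simp: S_def R_def)
  qed
  then have "finite S"
    using finite_lattice_inter_box[OF assms] by (rule finite_subset)
  moreover have "S \<noteq> {}"
    using v0 by (auto simp: S_def)
  ultimately obtain v where v: "v \<in> S" "\<And>w. w \<in> S \<Longrightarrow> ?N v \<le> ?N w"
    using ex_min_if_finite[of "?N ` S"] by (metis (no_types, lifting) finite_imageI image_is_empty image_iff not_less)
  show thesis
  proof
    show "v \<in> \<Lambda>" "v \<noteq> 0"
      using v(1) by (auto simp: S_def)
    show "?N v \<le> ?N w" if "w \<in> \<Lambda>" "w \<noteq> 0" for w
    proof (cases "?N w \<le> ?N v0")
      case True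
      then show ?thesis using v(2) that by (auto simp: S_def)
    next
      case False
      then show ?thesis using v(1) by (auto simp: S_def)
    qed
  qed
qed

text \<open>A shortest vector of \<open>g\<^sub>t \<Lambda>\<close> may be taken primitive and then has a partner \<open>q\<close> with
  determinant \<open>1\<close> or \<open>-1\<close>. Depending on which of its coordinates attains the norm, \<open>minimal_vector_det\<close> is applied
  to the coordinates in the given or in the exchanged order.\<close>

lemma sq_sys_le_1:
  assumes "unimodular_lattice \<Lambda>" shows "sq_sys \<Lambda> t \<le> 1"
proof -
  obtain A B where AB: "\<Lambda> = lattice_of A B" "\<bar>A $ 1 * B $ 2 - A $ 2 * B $ 1\<bar> = 1"
    using assms by (rule unimodular_latticeE)
  let ?N = "\<lambda>v. infnorm (diag_flow t *v v)"
  obtain v where v: "v \<in> \<Lambda>" "v \<noteq> 0" and min: "\<And>w. w \<in> \<Lambda> \<Longrightarrow> w \<noteq> 0 \<Longrightarrow> ?N v \<le> ?N w"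
    using sys_flow_attained[OF assms, of t] by blast
  obtain m n g :: int where mn: "coprime m n" "g \<noteq> 0" "v = of_int g *\<^sub>R (of_int m *\<^sub>R A + of_int n *\<^sub>R B)"
    using v unfolding AB(1) by (rule primitive_multiple)
  define p where "p = of_int m *\<^sub>R A + of_int n *\<^sub>R B"
  have p: "p \<in> \<Lambda>" "p \<noteq> 0" "v = of_int g *\<^sub>R p"
    using v(2) mn(3) by (auto simp: p_def AB(1) lattice_ofI)
  have min_p: "?N p \<le> ?N w" if "w \<in> \<Lambda>" "w \<noteq> 0" for w
  proof -
    have "1 \<le> \<bar>of_int g :: real\<bar>"
      using mn(2) by linarith
    then have "1 * ?N p \<le> \<bar>of_int g\<bar> * ?N p"
      by (intro mult_right_mono) (auto simp: infnorm_pos_le)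
    also have "\<dots> = ?N v"
      unfolding p(3) by (simp add: matrix_vector_mult_scaleR infnorm_mul)
    finally show ?thesis
      using min[OF that] by simp
  qed
  define s where "s = ?N p"
  have "sqrt (sq_sys \<Lambda> t) \<le> s"
  proof -
    have "avoids_box \<Lambda> (sqrt (sq_sys \<Lambda> t) * exp (- t)) (sqrt (sq_sys \<Lambda> t) * exp t)"
      using le_sq_sys_iff[OF assms, of "sq_sys \<Lambda> t" t] sq_sys_pos[OF assms, of t] by simp
    then have "sqrt (sq_sys \<Lambda> t) \<le> exp t * \<bar>p $ 1\<bar> \<or> sqrt (sq_sys \<Lambda> t) \<le> exp (- t) * \<bar>p $ 2\<bar>"
      using p(1,2) by (auto simp: avoids_box_def le_exp_flow_iff)
    then show ?thesis
      by (auto simp: s_def infnorm_2 abs_mult)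
  qed
  then have sq_le: "sq_sys \<Lambda> t \<le> s\<^sup>2"
    by (rule sqrt_le_D)
  obtain k l :: int where kl: "m * l - n * k = 1"
    using bezout_int[of m n] mn(1) by (metis coprime_iff_gcd_eq_1 diff_minus_eq_add mult.commute mult_minus_left)
  define q where "q = of_int k *\<^sub>R A + of_int l *\<^sub>R B"
  have "of_int m * of_int l - of_int n * of_int k = (1 :: real)"
    using kl by (metis of_int_1 of_int_diff of_int_mult)
  moreover have "p $ 1 * q $ 2 - p $ 2 * q $ 1 =
      (of_int m * of_int l - of_int n * of_int k) * (A $ 1 * B $ 2 - A $ 2 * B $ 1)"
    by (simp add: p_def q_def algebra_simps)
  ultimately have det_pq: "\<bar>p $ 1 * q $ 2 - p $ 2 * q $ 1\<bar> = 1"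
    using AB(2) by simp
  have far: "s \<le> \<bar>exp t * q $ 1 - of_int j * (exp t * p $ 1)\<bar> \<or> s \<le> \<bar>exp (- t) * q $ 2 - of_int j * (exp (- t) * p $ 2)\<bar>" for j :: int
  proof -
    have w: "q - of_int j *\<^sub>R p = of_int (k - j * m) *\<^sub>R A + of_int (l - j * n) *\<^sub>R B"
      by (simp add: p_def q_def algebra_simps)
    have "q - of_int j *\<^sub>R p \<noteq> 0"
    proof
      assume "q - of_int j *\<^sub>R p = 0"
      then have "q = of_int j *\<^sub>R p"
        by simp
      then show False
        using det_pq by simp
    qed
    moreover have "q - of_int j *\<^sub>R p \<in> \<Lambda>"
      unfolding w AB(1) by (rule lattice_ofI)
    ultimately have "s \<le> ?N (q - of_int j *\<^sub>R p)"
      unfolding s_def by (intro min_p)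
    then show ?thesis
      by (simp add: infnorm_2 le_max_iff_disj algebra_simps)
  qed
  have det1: "\<bar>exp t * p $ 1 * (exp (- t) * q $ 2) - exp (- t) * p $ 2 * (exp t * q $ 1)\<bar> = 1"
    using det_pq by (simp add: exp_minus field_simps)
  have det2: "\<bar>exp (- t) * p $ 2 * (exp t * q $ 1) - exp t * p $ 1 * (exp (- t) * q $ 2)\<bar> = 1"
    using det1 by (simp add: abs_minus_commute)
  have "0 < s"
    using p(2) unfolding s_def infnorm_pos_lt by (simp add: vec2_eq_0_iff)
  have s: "s = max \<bar>exp t * p $ 1\<bar> \<bar>exp (- t) * p $ 2\<bar>"
    by (simp add: s_def infnorm_2)
  then consider "s = \<bar>exp t * p $ 1\<bar>" "\<bar>exp (- t) * p $ 2\<bar> \<le> s" | "s = \<bar>exp (- t) * p $ 2\<bar>" "\<bar>exp t * p $ 1\<bar> \<le> s"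
    by linarith
  then have "s\<^sup>2 \<le> 1"
  proof cases
    case 1
    then show ?thesis
      using minimal_vector_det[of "exp t * p $ 1" "exp (- t) * p $ 2" "exp t * q $ 1" "exp (- t) * q $ 2"]
        far \<open>0 < s\<close> det1 by (metis power2_abs)
  next
    case 2
    then show ?thesis
      using minimal_vector_det[of "exp (- t) * p $ 2" "exp t * p $ 1" "exp (- t) * q $ 2" "exp t * q $ 1"]
        far \<open>0 < s\<close> det2 by (metis power2_abs)
  qed
  then show ?thesis
    using sq_le by linarith
qed

section \<open>The Mordell--Gruber constant\<close>

lemma coprime_proportional:
  fixes k l m n :: int
  assumes "m * l = n * k" "coprime m n"
  obtains j where "k = m * j" "l = n * j"
proof -
  obtain u v where "u * m + v * n = 1"
    using bezout_int[of m n] assms(2) by auto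
  then have "k = m * (u * k + v * l)" "l = n * (u * k + v * l)"
    using assms(1) by algebra+
  then show thesis
    by (rule that)
qed

text \<open>Determinants of lattice vectors are integers. A vector \<open>w\<close> in the box with half sides \<open>\<bar>p\<^sub>1\<bar>\<close> and
  \<open>(1 - \<bar>p\<^sub>1 p\<^sub>2\<bar>)/\<bar>p\<^sub>1\<bar>\<close> has \<open>\<bar>det(p, w)\<bar> < 1\<close> and so is a multiple of the primitive vector \<open>p\<close>,
  but the box is too narrow for nonzero multiples.\<close>

lemma one_minus_product_le_SUP_sq_sys_if_fst_nonzero:
  assumes uni: "unimodular_lattice \<Lambda>" and v: "v \<in> \<Lambda>" "v $ 1 \<noteq> 0"
  shows "ereal (1 - \<bar>v $ 1 * v $ 2\<bar>) \<le> (SUP t. ereal (sq_sys \<Lambda> t))"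
proof (cases "\<bar>v $ 1 * v $ 2\<bar> < 1")
  case False
  then have "1 - \<bar>v $ 1 * v $ 2\<bar> \<le> sq_sys \<Lambda> 0"
    using sq_sys_pos[OF uni, of 0] by linarith
  then show ?thesis
    by (intro SUP_upper2[of 0]) auto
next
  case True
  obtain A B where AB: "\<Lambda> = lattice_of A B" "\<bar>A $ 1 * B $ 2 - A $ 2 * B $ 1\<bar> = 1"
    using uni by (rule unimodular_latticeE)
  have "v \<noteq> 0"
    using v by auto
  then obtain m n g :: int where mn: "coprime m n" "g \<noteq> 0" "v = of_int g *\<^sub>R (of_int m *\<^sub>R A + of_int n *\<^sub>R B)"
    using v(1) \<open>v \<noteq> 0\<close> unfolding AB(1) by - (rule primitive_multiple)
  define p where "p = of_int m *\<^sub>R A + of_int n *\<^sub>R B"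
  have p1: "p $ 1 \<noteq> 0"
    using v(2) mn by (auto simp: p_def)
  have pp: "\<bar>p $ 1 * p $ 2\<bar> \<le> \<bar>v $ 1 * v $ 2\<bar>"
  proof -
    have "1 \<le> \<bar>of_int g :: real\<bar>"
      using mn(2) by linarith
    then have "1 * 1 \<le> \<bar>of_int g :: real\<bar> * \<bar>of_int g\<bar>"
      by (intro mult_mono) auto
    then have "1 * \<bar>p $ 1 * p $ 2\<bar> \<le> \<bar>of_int g\<bar> * \<bar>of_int g\<bar> * \<bar>p $ 1 * p $ 2\<bar>"
      by (intro mult_right_mono) auto
    also have "\<dots> = \<bar>v $ 1 * v $ 2\<bar>"
      unfolding mn(3) p_def[symmetric] by (simp add: abs_mult)
    finally show ?thesis by simp
  qed
  define X Y where "X = \<bar>p $ 1\<bar>" and "Y = (1 - \<bar>p $ 1 * p $ 2\<bar>) / \<bar>p $ 1\<bar>"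
  have pos: "0 < X" "0 < Y"
    using p1 pp True by (auto simp: X_def Y_def)
  have "avoids_box \<Lambda> X Y"
    unfolding avoids_box_def
  proof (intro ballI impI, rule ccontr)
    fix w assume w: "w \<in> \<Lambda>" "w \<noteq> 0" and small: "\<not> (X \<le> \<bar>w $ 1\<bar> \<or> Y \<le> \<bar>w $ 2\<bar>)"
    obtain k l :: int where kl: "w = of_int k *\<^sub>R A + of_int l *\<^sub>R B"
      using w(1) by (auto simp: AB(1) lattice_of_def)
    have "\<bar>of_int (m * l - n * k)\<bar> = \<bar>p $ 1 * w $ 2 - p $ 2 * w $ 1\<bar>"
    proof -
      have "p $ 1 * w $ 2 - p $ 2 * w $ 1 = of_int (m * l - n * k) * (A $ 1 * B $ 2 - A $ 2 * B $ 1)"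
        by (simp add: p_def kl algebra_simps)
      then show ?thesis
        using AB(2) by (simp add: abs_mult)
    qed
    also have "\<dots> \<le> \<bar>p $ 1\<bar> * \<bar>w $ 2\<bar> + \<bar>p $ 2\<bar> * \<bar>w $ 1\<bar>"
      by (metis abs_mult abs_triangle_ineq4)
    also have "\<dots> < \<bar>p $ 1\<bar> * Y + \<bar>p $ 2\<bar> * X"
      using small p1 by (intro add_less_le_mono mult_strict_left_mono mult_left_mono) auto
    also have "\<dots> = 1"
      using p1 by (simp add: X_def Y_def abs_mult)
    finally have "m * l = n * k"
      by linarith
    then obtain j where "k = m * j" "l = n * j"
      using mn(1) by (rule coprime_proportional)
    then have "w = of_int j *\<^sub>R p"
      by (simp add: kl p_def algebra_simps)
    moreover from this have "j \<noteq> 0"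
      using w(2) by auto
    then have "1 \<le> \<bar>of_int j :: real\<bar>"
      by linarith
    then have "1 * \<bar>p $ 1\<bar> \<le> \<bar>of_int j\<bar> * \<bar>p $ 1\<bar>"
      by (intro mult_right_mono) auto
    ultimately show False
      using small by (simp add: X_def abs_mult)
  qed
  then have "X * Y \<le> sq_sys \<Lambda> (ln (Y / X) / 2)"
    by (rule avoids_box_imp_le_sq_sys[OF uni pos])
  moreover have "X * Y = 1 - \<bar>p $ 1 * p $ 2\<bar>"
    using p1 by (simp add: X_def Y_def)
  ultimately have "1 - \<bar>v $ 1 * v $ 2\<bar> \<le> sq_sys \<Lambda> (ln (Y / X) / 2)"
    using pp by linarith
  then show ?thesis
    by (intro SUP_upper2[of "ln (Y / X) / 2"]) auto
qed

lemma SUP_sq_sys_swap: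
  assumes "unimodular_lattice \<Lambda>"
  shows "(SUP t. ereal (sq_sys (swap ` \<Lambda>) t)) = (SUP t. ereal (sq_sys \<Lambda> t))"
  unfolding sq_sys_swap[OF assms]
proof (rule antisym; rule SUP_least)
  show "ereal (sq_sys \<Lambda> (- t)) \<le> (SUP t. ereal (sq_sys \<Lambda> t))" for t
    by (rule SUP_upper) simp
  show "ereal (sq_sys \<Lambda> t) \<le> (SUP t. ereal (sq_sys \<Lambda> (- t)))" for t
    by (rule SUP_upper2[of "- t"]) auto
qed

lemma one_minus_product_le_SUP_sq_sys:
  assumes uni: "unimodular_lattice \<Lambda>" and v: "v \<in> \<Lambda>" "v \<noteq> 0"
  shows "ereal (1 - \<bar>v $ 1 * v $ 2\<bar>) \<le> (SUP t. ereal (sq_sys \<Lambda> t))"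
proof (cases "v $ 1 = 0")
  case True
  then have "swap v $ 1 \<noteq> 0" "swap v \<in> swap ` \<Lambda>"
    using v by (auto simp: vec2_eq_0_iff)
  then show ?thesis
    using one_minus_product_le_SUP_sq_sys_if_fst_nonzero[OF unimodular_swap[OF uni], of "swap v"]
    by (simp add: SUP_sq_sys_swap[OF uni] mult.commute)
qed (use one_minus_product_le_SUP_sq_sys_if_fst_nonzero[OF uni v(1)] in simp)

lemma mordell_const_eq_SUP_sq_sys:
  assumes "unimodular_lattice \<Lambda>"
  shows "mordell_const \<Lambda> = (SUP t. ereal (sq_sys \<Lambda> t))"
proof (rule antisym)
  show "mordell_const \<Lambda> \<le> (SUP t. ereal (sq_sys \<Lambda> t))"
    unfolding mordell_const_def
  proof (rule Sup_least, clarify)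
    fix x y assume adm: "admissible \<Lambda> x y"
    then have pos: "0 < x" "0 < y" and box: "{v \<in> \<Lambda>. v $ 1 \<in> {- x..x} \<and> v $ 2 \<in> {- y..y}} = {0}"
      by (auto simp: admissible_def)
    have "avoids_box \<Lambda> x y"
      unfolding avoids_box_def
    proof (intro ballI impI, rule ccontr)
      fix v assume "v \<in> \<Lambda>" "v \<noteq> 0" "\<not> (x \<le> \<bar>v $ 1\<bar> \<or> y \<le> \<bar>v $ 2\<bar>)"
      then have "v \<in> {v \<in> \<Lambda>. v $ 1 \<in> {- x..x} \<and> v $ 2 \<in> {- y..y}}"
        by auto
      then show False
        using box \<open>v \<noteq> 0\<close> by blast
    qed
    then show "ereal (x * y) \<le> (SUP t. ereal (sq_sys \<Lambda> t))"
      using avoids_box_imp_le_sq_sys[OF assms pos]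
      by (intro SUP_upper2[of "ln (y / x) / 2"]) auto
  qed
  have zero: "0 \<in> \<Lambda>"
  proof -
    obtain A B where "\<Lambda> = lattice_of A B"
      using assms by (auto elim: unimodular_latticeE)
    then show ?thesis
      using lattice_ofI[of 0 A 0 B] by simp
  qed
  have small: "ereal c \<le> mordell_const \<Lambda>" if c: "0 < c" "c < sq_sys \<Lambda> t" for c t
  proof -
    let ?x = "sqrt c * exp (- t)" and ?y = "sqrt c * exp t"
    let ?X = "sqrt (sq_sys \<Lambda> t) * exp (- t)" and ?Y = "sqrt (sq_sys \<Lambda> t) * exp t"
    have lt: "?x < ?X" "?y < ?Y"
      using c by simp_all
    have box: "avoids_box \<Lambda> ?X ?Y"
      using le_sq_sys_iff[OF assms, of "sq_sys \<Lambda> t" t] sq_sys_pos[OF assms, of t] by simp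
    have "v = 0" if v: "v \<in> \<Lambda>" "\<bar>v $ 1\<bar> \<le> ?x" "\<bar>v $ 2\<bar> \<le> ?y" for v
    proof (rule ccontr)
      assume "v \<noteq> 0"
      then have "?X \<le> \<bar>v $ 1\<bar> \<or> ?Y \<le> \<bar>v $ 2\<bar>"
        using box v(1) by (simp add: avoids_box_def)
      then show False
        using v(2,3) lt by linarith
    qed
    moreover have "0 < ?x" "0 < ?y"
      using c by simp_all
    moreover from this have "\<bar>0 $ 1 :: real\<bar> \<le> ?x"  "\<bar>0 $ 2 :: real\<bar> \<le> ?y"
      by simp_all
    ultimately have "admissible \<Lambda> ?x ?y"
      using zero unfolding admissible_def by (fastforce simp: abs_le_iff)
    moreover have "c = ?x * ?y"
      using c by (simp add: exp_minus field_simps)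
    then have "ereal c = ereal (?x * ?y)"
      by (rule arg_cong)
    ultimately show ?thesis
      unfolding mordell_const_def by (intro Sup_upper) blast
  qed
  show "(SUP t. ereal (sq_sys \<Lambda> t)) \<le> mordell_const \<Lambda>"
  proof (rule SUP_least, rule dense_le)
    fix t y assume y: "y < ereal (sq_sys \<Lambda> t)"
    show "y \<le> mordell_const \<Lambda>"
    proof (cases "0 < y")
      case True
      then obtain c where "y = ereal c"
        using y by (cases y) auto
      then show ?thesis
        using True y small[of c t] by simp
    next
      case False
      have "0 < sq_sys \<Lambda> t / 2" "sq_sys \<Lambda> t / 2 < sq_sys \<Lambda> t"
        using sq_sys_pos[OF assms, of t] by auto
      then have "ereal (sq_sys \<Lambda> t / 2) \<le> mordell_const \<Lambda>" "0 \<le> ereal (sq_sys \<Lambda> t / 2)"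
        by (rule small) (use sq_sys_pos[OF assms, of t] in simp)
      then show ?thesis
        using False by (meson order.trans not_less)
    qed
  qed
qed

section \<open>The four spectra\<close>

lemma exp_log_systole_eqs:
  assumes "unimodular_lattice \<Lambda>"
  shows "exp_ereal (- 2 * Liminf at_infinity (\<lambda>t. ereal (log_systole \<Lambda> t))) =
      Limsup at_infinity (\<lambda>t. ereal (inverse (sq_sys \<Lambda> t)))"
    "exp_ereal (- 2 * (INF t. ereal (log_systole \<Lambda> t))) = (SUP t. ereal (inverse (sq_sys \<Lambda> t)))"
    "exp_ereal (2 * Limsup at_infinity (\<lambda>t. ereal (log_systole \<Lambda> t))) =
      Limsup at_infinity (\<lambda>t. ereal (sq_sys \<Lambda> t))"
    "exp_ereal (2 * (SUP t. ereal (log_systole \<Lambda> t))) = (SUP t. ereal (sq_sys \<Lambda> t))"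
proof -
  have "\<not> eventually (\<lambda>_. False) (top :: real filter)"
    by (simp only: eventually_top simp_thms)
  then have ne: "(at_infinity :: real filter) \<noteq> bot" "(top :: real filter) \<noteq> bot"
    using trivial_limit_at_infinity by (blast, metis eventually_bot)
  show "exp_ereal (- 2 * Liminf at_infinity (\<lambda>t. ereal (log_systole \<Lambda> t))) =
      Limsup at_infinity (\<lambda>t. ereal (inverse (sq_sys \<Lambda> t)))"
    "exp_ereal (2 * Limsup at_infinity (\<lambda>t. ereal (log_systole \<Lambda> t))) =
      Limsup at_infinity (\<lambda>t. ereal (sq_sys \<Lambda> t))"
    unfolding Limsup_exp_ereal_minus[OF ne(1)] Limsup_exp_ereal[OF ne(1)] exp_ereal_log_systole[OF assms]
    by (rule refl)+
  show "exp_ereal (- 2 * (INF t. ereal (log_systole \<Lambda> t))) = (SUP t. ereal (inverse (sq_sys \<Lambda> t)))"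
    "exp_ereal (2 * (SUP t. ereal (log_systole \<Lambda> t))) = (SUP t. ereal (sq_sys \<Lambda> t))"
    unfolding Limsup_top_filter[symmetric] Liminf_top_filter[symmetric]
      Limsup_exp_ereal_minus[OF ne(2)] Limsup_exp_ereal[OF ne(2)] exp_ereal_log_systole[OF assms]
    by (rule refl)+
qed

definition markov_const :: "real \<Rightarrow> real \<Rightarrow> real \<Rightarrow> ereal" where
  "markov_const a b c = inverse (INF (x, y) \<in> (UNIV :: (int \<times> int) set) - {(0, 0)}.
    ereal \<bar>a * (of_int x)\<^sup>2 + b * of_int x * of_int y + c * (of_int y)\<^sup>2\<bar>)"

text \<open>\<open>S(t)\<close> is never below the infimum, and every \<open>v\<close> off the axes has
  \<open>S(t) \<le> \<bar>v\<^sub>1 v\<^sub>2\<bar>\<close> for some \<open>t\<close>. In a bi-infinite lattice these are all nonzero points.\<close>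

lemma SUP_inverse_sq_sys_eq_inverse_INF:
  assumes uni: "unimodular_lattice \<Lambda>" and bi: "bi_infinite \<Lambda>"
  shows "(SUP t. ereal (inverse (sq_sys \<Lambda> t))) = inverse (INF v\<in>\<Lambda> - {0}. ereal \<bar>v $ 1 * v $ 2\<bar>)"
    (is "?S = inverse ?J")
proof (rule antisym)
  obtain v0 where v0: "v0 \<in> \<Lambda>" "v0 \<noteq> 0"
    using unimodular_nonzero[OF uni] by blast
  have "0 \<le> ?J"
    by (intro INF_greatest) auto
  moreover have "?J \<le> ereal \<bar>v0 $ 1 * v0 $ 2\<bar>"
    using v0 by (intro INF_lower) auto
  ultimately obtain j where j: "?J = ereal j" "0 \<le> j"
    by (cases ?J) auto
  have "inverse (ereal (sq_sys \<Lambda> t)) \<le> inverse ?J" for t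
  proof (rule ereal_inverse_antimono)
    show "0 \<le> ?J" by fact
    have "j \<le> sq_sys \<Lambda> t"
    proof (rule sq_sys_ge[OF uni j(2)])
      fix v assume "v \<in> \<Lambda>" "v \<noteq> 0"
      then have "?J \<le> ereal \<bar>v $ 1 * v $ 2\<bar>"
        by (intro INF_lower) auto
      then show "j \<le> \<bar>v $ 1 * v $ 2\<bar>"
        by (simp add: j(1))
    qed
    then show "?J \<le> ereal (sq_sys \<Lambda> t)"
      by (simp add: j(1))
  qed
  then show "?S \<le> inverse ?J"
    using sq_sys_pos[OF uni] by (intro SUP_least) (simp add: less_imp_neq[symmetric])
  have S_ge: "ereal (inverse (sq_sys \<Lambda> t)) \<le> ?S" for t
    by (rule SUP_upper) simp
  moreover have "0 < ereal (inverse (sq_sys \<Lambda> 0))"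
    using sq_sys_pos[OF uni] by simp
  ultimately have "0 < ?S"
    by (rule order.strict_trans2[rotated])
  have "inverse ?S \<le> ?J"
  proof (rule INF_greatest)
    fix v assume v: "v \<in> \<Lambda> - {0}"
    then have nz: "v $ 1 \<noteq> 0" "v $ 2 \<noteq> 0"
      using bi by (auto simp: bi_infinite_def)
    let ?t = "ln (\<bar>v $ 2\<bar> / \<bar>v $ 1\<bar>) / 2"
    have "inverse ?S \<le> inverse (ereal (inverse (sq_sys \<Lambda> ?t)))"
      using S_ge[of ?t] sq_sys_pos[OF uni, of ?t] by (intro ereal_inverse_antimono) auto
    also have "\<dots> = ereal (sq_sys \<Lambda> ?t)"
      using sq_sys_pos[OF uni, of ?t] by simp
    also have "\<dots> \<le> ereal \<bar>v $ 1 * v $ 2\<bar>"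
      using sq_sys_le_product[OF uni _ nz] v by simp
    finally show "inverse ?S \<le> ereal \<bar>v $ 1 * v $ 2\<bar>" .
  qed
  moreover have "0 \<le> inverse ?S"
    using \<open>0 < ?S\<close> by (simp add: ereal_inverse_nonneg_iff)
  ultimately have "inverse ?J \<le> inverse (inverse ?S)"
    by (intro ereal_inverse_antimono)
  also have "inverse (inverse ?S) = ?S"
    using \<open>0 < ?S\<close> by (cases ?S) auto
  finally show "inverse ?J \<le> ?S" .
qed

lemma SUP_inverse_sq_sys_eq_markov_const:
  fixes A B :: "real^2"
  assumes det: "\<bar>A $ 1 * B $ 2 - A $ 2 * B $ 1\<bar> = 1" and bi: "bi_infinite (lattice_of A B)"
  shows "(SUP t. ereal (inverse (sq_sys (lattice_of A B) t))) =
    markov_const (A $ 1 * A $ 2) (A $ 1 * B $ 2 + A $ 2 * B $ 1) (B $ 1 * B $ 2)"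
proof -
  let ?v = "\<lambda>(x :: int, y :: int). of_int x *\<^sub>R A + of_int y *\<^sub>R B"
  have pts: "lattice_of A B - {0} = ?v ` (UNIV - {(0, 0)})"
    using lattice_comb_eq_0_iff[OF det] by (auto simp: lattice_of_def image_iff)
  have prod: "?v z $ 1 * ?v z $ 2 = (case z of (x, y) \<Rightarrow> A $ 1 * A $ 2 * (of_int x)\<^sup>2 +
      (A $ 1 * B $ 2 + A $ 2 * B $ 1) * of_int x * of_int y + B $ 1 * B $ 2 * (of_int y)\<^sup>2)" for z
    by (cases z) (simp add: power2_eq_square algebra_simps)
  show ?thesis
    unfolding SUP_inverse_sq_sys_eq_inverse_INF[OF unimodular_latticeI[OF det] bi] markov_const_def
      pts image_image prod
    by (auto intro!: arg_cong[where f = inverse] INF_cong)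
qed

text \<open>If the form does not represent \<open>0\<close>, then \<open>a \<noteq> 0\<close> and discriminant \<open>1\<close> gives the factorisation
  \<open>(a x + (b - 1)/2 y) (x + (b + 1)/(2 a) y)\<close> into linear forms of determinant \<open>1\<close>. The two factors are
  the coordinates of the points of a lattice.\<close>

lemma markov_const_infinite_or_bi_infinite:
  fixes a b c :: real
  assumes "b\<^sup>2 - 4 * a * c = 1"
  shows "markov_const a b c = \<infinity> \<or> (\<exists>\<Lambda>. unimodular_lattice \<Lambda> \<and> bi_infinite \<Lambda> \<and>
    markov_const a b c = (SUP t. ereal (inverse (sq_sys \<Lambda> t))))"
proof (cases "\<exists>x y :: int. (x, y) \<noteq> (0, 0) \<and> a * (of_int x)\<^sup>2 + b * of_int x * of_int y + c * (of_int y)\<^sup>2 = 0")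
  case True
  then obtain x y :: int where xy: "(x, y) \<noteq> (0, 0)" "a * (of_int x)\<^sup>2 + b * of_int x * of_int y + c * (of_int y)\<^sup>2 = 0"
    by blast
  let ?J = "INF (x, y) \<in> (UNIV :: (int \<times> int) set) - {(0, 0)}.
        ereal \<bar>a * (of_int x)\<^sup>2 + b * of_int x * of_int y + c * (of_int y)\<^sup>2\<bar>"
  have "?J \<le> 0"
    using xy by (intro INF_lower2[of "(x, y)"]) auto
  moreover have "0 \<le> ?J"
    by (intro INF_greatest) auto
  ultimately show ?thesis
    unfolding markov_const_def by simp
next
  case False
  have "a \<noteq> 0"
    using False[simplified, rule_format, of 1 0] by auto
  define A B :: "real^2" where "A = vector [a, 1]" and "B = vector [(b - 1) / 2, (b + 1) / (2 * a)]"
  have A: "A $ 1 = a" "A $ 2 = 1" and B: "B $ 1 = (b - 1) / 2" "B $ 2 = (b + 1) / (2 * a)"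
    by (simp_all add: A_def B_def vector_2)
  have "A $ 1 * B $ 2 - A $ 2 * B $ 1 = 1"
    using \<open>a \<noteq> 0\<close> by (simp add: A B field_simps)
  then have det: "\<bar>A $ 1 * B $ 2 - A $ 2 * B $ 1\<bar> = 1"
    by simp
  have coeffs: "A $ 1 * A $ 2 = a" "A $ 1 * B $ 2 + A $ 2 * B $ 1 = b" "B $ 1 * B $ 2 = c"
  proof -
    have "b * b - 1 = 4 * a * c"
      using assms by (simp add: power2_eq_square)
    then show "B $ 1 * B $ 2 = c"
      using \<open>a \<noteq> 0\<close> by (simp add: B field_simps)
  qed (use \<open>a \<noteq> 0\<close> in \<open>simp_all add: A B field_simps\<close>)
  have "bi_infinite (lattice_of A B)"
    unfolding bi_infinite_def
  proof (intro ballI impI)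
    fix v assume v: "v \<in> lattice_of A B" "v $ 1 = 0 \<or> v $ 2 = 0"
    obtain x y :: int where xy: "v = of_int x *\<^sub>R A + of_int y *\<^sub>R B"
      using v(1) by (auto simp: lattice_of_def)
    have "v $ 1 * v $ 2 = A $ 1 * A $ 2 * (of_int x)\<^sup>2 +
        (A $ 1 * B $ 2 + A $ 2 * B $ 1) * of_int x * of_int y + B $ 1 * B $ 2 * (of_int y)\<^sup>2"
      by (simp add: xy power2_eq_square algebra_simps)
    moreover have "v $ 1 * v $ 2 = 0"
      using v(2) by auto
    ultimately have "(x, y) = (0, 0)"
      using False unfolding coeffs by fastforce
    then show "v = 0"
      by (simp add: xy)
  qed
  then show ?thesis
    using SUP_inverse_sq_sys_eq_markov_const[OF det] unimodular_latticeI[OF det] unfolding coeffs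
    by (intro disjI2 exI[of _ "lattice_of A B"]) simp
qed

text \<open>One lattice with both exceptional values: an infinite Lagrange constant makes
  the infimum of \<open>\<bar>v\<^sub>1 v\<^sub>2\<bar>\<close> vanish, and then there are empty boxes whose half sides have a product arbitrarily
  close to \<open>1\<close>.\<close>

lemma bi_infinite_lattice_extreme_sys:
  obtains \<Lambda> where "unimodular_lattice \<Lambda>" "bi_infinite \<Lambda>"
    "(SUP t. ereal (inverse (sq_sys \<Lambda> t))) = \<infinity>" "(SUP t. ereal (sq_sys \<Lambda> t)) = 1"
proof -
  obtain \<alpha> where \<alpha>: "\<alpha> \<notin> \<rat>" "lagrange_const \<alpha> = \<infinity>"
    using ex_lagrange_const_infinite by blast
  obtain \<Lambda> where uni: "unimodular_lattice \<Lambda>" and bi: "bi_infinite \<Lambda>"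
    and lim: "Limsup at_infinity (\<lambda>t. ereal (inverse (sq_sys \<Lambda> t))) = lagrange_const \<alpha>"
    using \<alpha>(1) by (rule bi_infinite_lattice_of_irrational)
  have "Limsup at_infinity (\<lambda>t. ereal (inverse (sq_sys \<Lambda> t))) \<le> (SUP t. ereal (inverse (sq_sys \<Lambda> t)))"
    by (intro Limsup_bounded always_eventually allI SUP_upper) simp
  then have inf: "(SUP t. ereal (inverse (sq_sys \<Lambda> t))) = \<infinity>"
    using lim \<alpha>(2) by simp
  have "(SUP t. ereal (sq_sys \<Lambda> t)) = 1"
  proof (rule antisym)
    show "(SUP t. ereal (sq_sys \<Lambda> t)) \<le> 1"
      by (intro SUP_least) (simp add: sq_sys_le_1[OF uni])
    have INF_0: "(INF v\<in>\<Lambda> - {0}. ereal \<bar>v $ 1 * v $ 2\<bar>) = 0"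
      using inf unfolding SUP_inverse_sq_sys_eq_inverse_INF[OF uni bi] by (simp add: ereal_inverse_eq_0)
    show "1 \<le> (SUP t. ereal (sq_sys \<Lambda> t))"
    proof (rule ereal_le_epsilon2)
      fix e :: real assume "0 < e"
      then have "(INF v\<in>\<Lambda> - {0}. ereal \<bar>v $ 1 * v $ 2\<bar>) < ereal e"
        by (simp add: INF_0)
      then obtain v where v: "v \<in> \<Lambda>" "v \<noteq> 0" "\<bar>v $ 1 * v $ 2\<bar> < e"
        by (auto simp: INF_less_iff)
      have "1 = ereal (1 - \<bar>v $ 1 * v $ 2\<bar>) + ereal \<bar>v $ 1 * v $ 2\<bar>"
        by (simp add: one_ereal_def)
      also have "\<dots> \<le> (SUP t. ereal (sq_sys \<Lambda> t)) + ereal e"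
        using v by (intro add_mono one_minus_product_le_SUP_sq_sys[OF uni]) auto
      finally show "1 \<le> (SUP t. ereal (sq_sys \<Lambda> t)) + ereal e" .
    qed
  qed
  then show thesis
    using that uni bi inf by blast
qed

lemma mordell_const_not_bi_infinite:
  assumes uni: "unimodular_lattice \<Lambda>" and "\<not> bi_infinite \<Lambda>"
  shows "mordell_const \<Lambda> = 1"
proof -
  obtain v where v: "v \<in> \<Lambda>" "v \<noteq> 0" "v $ 1 * v $ 2 = 0"
    using assms(2) by (auto simp: bi_infinite_def)
  have "1 \<le> (SUP t. ereal (sq_sys \<Lambda> t))"
    using one_minus_product_le_SUP_sq_sys[OF uni v(1,2)] unfolding v(3) by (simp add: one_ereal_def)
  moreover have "(SUP t. ereal (sq_sys \<Lambda> t)) \<le> 1"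
    by (intro SUP_least) (simp add: sq_sys_le_1[OF uni])
  ultimately show ?thesis
    by (simp add: mordell_const_eq_SUP_sq_sys[OF uni])
qed

theorem theorem23:
  shows "lagrange_spectrum =
      {exp_ereal (- 2 * Liminf at_infinity (\<lambda>t. ereal (log_systole \<Lambda> t))) | \<Lambda>.
        unimodular_lattice \<Lambda> \<and> bi_infinite \<Lambda>}
    \<and> markov_spectrum =
      {exp_ereal (- 2 * (INF t. ereal (log_systole \<Lambda> t))) | \<Lambda>.
        unimodular_lattice \<Lambda> \<and> bi_infinite \<Lambda>}
    \<and> dirichlet_spectrum =
      {exp_ereal (2 * Limsup at_infinity (\<lambda>t. ereal (log_systole \<Lambda> t))) | \<Lambda>.
        unimodular_lattice \<Lambda> \<and> bi_infinite \<Lambda>}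
    \<and> mordell_gruber_spectrum =
      {exp_ereal (2 * (SUP t. ereal (log_systole \<Lambda> t))) | \<Lambda>.
        unimodular_lattice \<Lambda> \<and> bi_infinite \<Lambda>}"
proof -
  have max_in: "max x y \<in> S" if "x \<in> S" "y \<in> S" for x y :: ereal and S
    using that by (simp add: max_def)
  have lagrange: "lagrange_spectrum = {Limsup at_infinity (\<lambda>t. ereal (inverse (sq_sys \<Lambda> t))) | \<Lambda>.
      unimodular_lattice \<Lambda> \<and> bi_infinite \<Lambda>}" (is "_ = ?L")
  proof
    show "lagrange_spectrum \<subseteq> ?L"
    proof
      fix x assume "x \<in> lagrange_spectrum"
      then obtain \<alpha> where \<alpha>: "x = lagrange_const \<alpha>" "\<alpha> \<notin> \<rat>"
        unfolding lagrange_spectrum_def lagrange_const_def[symmetric] by blast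
      obtain \<Lambda> where "unimodular_lattice \<Lambda>" "bi_infinite \<Lambda>"
        "Limsup at_infinity (\<lambda>t. ereal (inverse (sq_sys \<Lambda> t))) = lagrange_const \<alpha>"
        using \<alpha>(2) by (rule bi_infinite_lattice_of_irrational)
      then show "x \<in> ?L"
        unfolding \<alpha>(1) by (intro CollectI exI[of _ \<Lambda>]) simp
    qed
    have in_spectrum: "lagrange_const \<alpha> \<in> lagrange_spectrum" if "\<alpha> \<notin> \<rat>" for \<alpha>
      unfolding lagrange_spectrum_def lagrange_const_def[symmetric] using that by blast
    have "Limsup at_infinity (\<lambda>t. ereal (inverse (sq_sys \<Lambda> t))) \<in> lagrange_spectrum"
      if "unimodular_lattice \<Lambda>" "bi_infinite \<Lambda>" for \<Lambda>
      using that by (rule Limsup_at_infinity_eq_slope_consts) (simp add: max_in in_spectrum)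
    then show "?L \<subseteq> lagrange_spectrum"
      by blast
  qed
  have dirichlet: "dirichlet_spectrum = {Limsup at_infinity (\<lambda>t. ereal (sq_sys \<Lambda> t)) | \<Lambda>.
      unimodular_lattice \<Lambda> \<and> bi_infinite \<Lambda>}" (is "_ = ?D")
  proof
    show "dirichlet_spectrum \<subseteq> ?D"
    proof
      fix x assume "x \<in> dirichlet_spectrum"
      then obtain \<alpha> where \<alpha>: "x = dirichlet_const \<alpha>" "\<alpha> \<notin> \<rat>"
        unfolding dirichlet_spectrum_def by blast
      obtain \<Lambda> where "unimodular_lattice \<Lambda>" "bi_infinite \<Lambda>"
        "Limsup at_infinity (\<lambda>t. ereal (sq_sys \<Lambda> t)) = dirichlet_const \<alpha>"
        using \<alpha>(2) by (rule bi_infinite_lattice_of_irrational)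
      then show "x \<in> ?D"
        unfolding \<alpha>(1) by (intro CollectI exI[of _ \<Lambda>]) simp
    qed
    have in_spectrum: "dirichlet_const \<alpha> \<in> dirichlet_spectrum" if "\<alpha> \<notin> \<rat>" for \<alpha>
      unfolding dirichlet_spectrum_def using that by blast
    have "Limsup at_infinity (\<lambda>t. ereal (sq_sys \<Lambda> t)) \<in> dirichlet_spectrum"
      if "unimodular_lattice \<Lambda>" "bi_infinite \<Lambda>" for \<Lambda>
      using that by (rule Limsup_at_infinity_eq_slope_consts) (simp add: max_in in_spectrum)
    then show "?D \<subseteq> dirichlet_spectrum"
      by blast
  qed
  obtain \<Lambda>1 where \<Lambda>1: "unimodular_lattice \<Lambda>1" "bi_infinite \<Lambda>1"
    "(SUP t. ereal (inverse (sq_sys \<Lambda>1 t))) = \<infinity>" "(SUP t. ereal (sq_sys \<Lambda>1 t)) = 1"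
    by (rule bi_infinite_lattice_extreme_sys)
  have markov: "markov_spectrum = {(SUP t. ereal (inverse (sq_sys \<Lambda> t))) | \<Lambda>.
      unimodular_lattice \<Lambda> \<and> bi_infinite \<Lambda>}" (is "_ = ?M")
  proof
    have "\<infinity> \<in> ?M"
      using \<Lambda>1 by (intro CollectI exI[of _ \<Lambda>1]) simp
    then have "markov_const a b c \<in> ?M" if "b\<^sup>2 - 4 * a * c = 1" for a b c
      using markov_const_infinite_or_bi_infinite[OF that]
    proof (elim disjE exE conjE)
      fix \<Lambda>
      assume "unimodular_lattice \<Lambda>" "bi_infinite \<Lambda>"
        "markov_const a b c = (SUP t. ereal (inverse (sq_sys \<Lambda> t)))"
      then show "markov_const a b c \<in> ?M"
        by (intro CollectI exI[of _ \<Lambda>]) simp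
    qed simp
    then show "markov_spectrum \<subseteq> ?M"
      unfolding markov_spectrum_def markov_const_def[symmetric] by blast
    have "(SUP t. ereal (inverse (sq_sys \<Lambda> t))) \<in> markov_spectrum"
      if uni: "unimodular_lattice \<Lambda>" and bi: "bi_infinite \<Lambda>" for \<Lambda>
    proof -
      obtain A B where AB: "\<Lambda> = lattice_of A B" "\<bar>A $ 1 * B $ 2 - A $ 2 * B $ 1\<bar> = 1"
        using uni by (rule unimodular_latticeE)
      have "(A $ 1 * B $ 2 + A $ 2 * B $ 1)\<^sup>2 - 4 * (A $ 1 * A $ 2) * (B $ 1 * B $ 2)
          = \<bar>A $ 1 * B $ 2 - A $ 2 * B $ 1\<bar>\<^sup>2"
        unfolding power2_abs by (simp add: power2_eq_square algebra_simps)
      also have "\<dots> = 1"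
        by (simp add: AB(2))
      finally show ?thesis
        using SUP_inverse_sq_sys_eq_markov_const[OF AB(2)] bi unfolding AB(1)
        unfolding markov_spectrum_def markov_const_def[symmetric] by blast
    qed
    then show "?M \<subseteq> markov_spectrum"
      by blast
  qed
  have mordell: "mordell_gruber_spectrum = {(SUP t. ereal (sq_sys \<Lambda> t)) | \<Lambda>.
      unimodular_lattice \<Lambda> \<and> bi_infinite \<Lambda>}" (is "_ = ?G")
  proof
    have "mordell_const \<Lambda> \<in> ?G" if uni: "unimodular_lattice \<Lambda>" for \<Lambda>
    proof (cases "bi_infinite \<Lambda>")
      case True
      then show ?thesis
        using mordell_const_eq_SUP_sq_sys[OF uni] uni by blast
    next
      case False
      have "1 \<in> ?G"
        using \<Lambda>1 by (intro CollectI exI[of _ \<Lambda>1]) simp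
      then show ?thesis
        by (simp only: mordell_const_not_bi_infinite[OF uni False])
    qed
    then show "mordell_gruber_spectrum \<subseteq> ?G"
      unfolding mordell_gruber_spectrum_def by blast
    have "(SUP t. ereal (sq_sys \<Lambda> t)) \<in> mordell_gruber_spectrum" if "unimodular_lattice \<Lambda>" for \<Lambda>
      unfolding mordell_gruber_spectrum_def mordell_const_eq_SUP_sq_sys[OF that, symmetric] using that by blast
    then show "?G \<subseteq> mordell_gruber_spectrum"
      by blast
  qed
  have cong: "{f \<Lambda> | \<Lambda>. unimodular_lattice \<Lambda> \<and> bi_infinite \<Lambda>} = {g \<Lambda> | \<Lambda>. unimodular_lattice \<Lambda> \<and> bi_infinite \<Lambda>}"
    if "\<And>\<Lambda>. unimodular_lattice \<Lambda> \<Longrightarrow> f \<Lambda> = g \<Lambda>" for f g :: "(real^2) set \<Rightarrow> ereal"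
    by (intro Collect_cong ex_cong1) (use that in auto)
  show ?thesis
    unfolding lagrange dirichlet markov mordell
    by (intro conjI; rule cong) (simp_all only: exp_log_systole_eqs)
qed

end
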